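(* Let $2<p<\infty$. (i) Let $g$ be an analytic function in $\mathbb{D}$. If $T_g:\mathcal{D}^p_{p-1}\to H^p$ is bounded, then $g\in\mathrm{BMOA}$. (ii) There exist $g\in\mathcal{A}$ and $f\in\mathcal{D}^p_{p-1}$ such that $T_g(f)\notin H^p$.
   Context: $\mathbb{D}=\{z\in\mathbb{C}:|z|<1\}$, $\mathbb{T}=\partial\mathbb{D}$, $\mathcal{H}(\mathbb{D})$ is the space of analytic functions in $\mathbb{D}$, and $dA(z)=\frac{dx\,dy}{\pi}$. The disc algebra $\mathcal{A}$ is the space of all analytic functions in $\mathbb{D}$ that are continuous up to the boundary $\mathbb{T}$ (i.e. extend continuously to $\overline{\mathbb{D}}$). For $0<p<\infty$, the Hardy space $H^p$ consists of $f\in\mathcal{H}(\mathbb{D})$ with $\|f\|_{H^p}=\lim_{r\to1^-}\left(\frac{1}{2\pi}\int_0^{2\pi}|f(re^{i\theta})|^p\,d\theta\right)^{1/p}<\infty$. The Dirichlet-type space $\mathcal{D}^p_{p-1}$ consists of $f\in\mathcal{H}(\mathbb{D})$ with $\|f\|_{\mathcal{D}^p_{p-1}}^p=\int_{\mathbb{D}}|f'(z)|^p(1-|z|^2)^{p-1}\,dA(z)+|f(0)|^p<\infty$. For $g\in\mathcal{H}(\mathbb{D})$, $T_g(f)(z)=\int_0^z f(\zeta)g'(\zeta)\,d\zeta$, $z\in\mathbb{D}$. The operator $T_g:X\to Y$ is bounded if there is a constant $C$ with $\|T_g(f)\|_Y\le C\|f\|_X$ for all $f\in X$. For an arc $I\subset\mathbb{T}$,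 $|I|$ is its normalized Lebesgue measure ($|\mathbb{T}|=1$) and $S(I)=\{re^{it}:e^{it}\in I,\ 1-|I|\le r<1\}$. For $a\in\mathbb{D}\setminus\{0\}$, $I_a=\{e^{i\theta}:|\arg(ae^{-i\theta})|\le\pi(1-|a|)\}$ and $S(a)=S(I_a)$. The space $\mathrm{BMOA}$ (functions in $H^1$ with bounded mean oscillation on $\mathbb{T}$) consists of those $g\in\mathcal{H}(\mathbb{D})$ with $$\|g\|_{\mathrm{BMOA}}^2=\sup_{a}\frac{\int_{S(a)}|g'(z)|^2(1-|z|^2)\,dA(z)}{1-|a|}+|g(0)|^2<\infty,$$ the supremum being over $a\in\mathbb{D}\setminus\{0\}$. *)

theory Defs
  imports "HOL-Complex_Analysis.Complex_Analysis"
begin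

abbreviation unit_disc :: "complex set" where
  "unit_disc \<equiv> ball 0 1"

definition disc_area :: "complex measure" where
  "disc_area = scale_measure (ennreal (1 / pi)) lborel"

definition disc_algebra :: "(complex \<Rightarrow> complex) set" where
  "disc_algebra = {f. f holomorphic_on unit_disc \<and>
     (\<exists>F. continuous_on (closure unit_disc) F \<and> (\<forall>z\<in>unit_disc. F z = f z))}"

definition hardy_mean :: "real \<Rightarrow> (complex \<Rightarrow> complex) \<Rightarrow> real \<Rightarrow> real" where
  "hardy_mean p f r =
     (1 / (2 * pi) * integral {0..2 * pi} (\<lambda>\<theta>. norm (f (of_real r * cis \<theta>)) powr p)) powr (1 / p)"

text \<open>
  For holomorphic \<open>f\<close> and \<open>p > 0\<close> the means increase with \<open>r < 1\<close>, so the limit always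
  exists in \<^typ>\<open>ennreal\<close>; it may be infinite.
\<close>

definition hardy_limit :: "real \<Rightarrow> (complex \<Rightarrow> complex) \<Rightarrow> ennreal" where
  "hardy_limit p f = Lim (at_left 1) (\<lambda>r. ennreal (hardy_mean p f r))"

definition hardy_space :: "real \<Rightarrow> (complex \<Rightarrow> complex) set" where
  "hardy_space p = {f. f holomorphic_on unit_disc \<and> hardy_limit p f < \<infinity>}"

definition hardy_norm :: "real \<Rightarrow> (complex \<Rightarrow> complex) \<Rightarrow> real" where
  "hardy_norm p f = enn2real (hardy_limit p f)"

text \<open>The \<open>p\<close>-th power of the norm of the space \<open>D\<^sup>p\<^bsub>p-1\<^esub>\<close>, with infinite value allowed.\<close>

definition dirichlet_energy :: "real \<Rightarrow> (complex \<Rightarrow> complex) \<Rightarrow> ennreal" where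
  "dirichlet_energy p f =
     (\<integral>\<^sup>+z\<in>unit_disc. ennreal (norm (deriv f z) powr p * (1 - (norm z)\<^sup>2) powr (p - 1)) \<partial>disc_area)
     + ennreal (norm (f 0) powr p)"

definition dirichlet_space :: "real \<Rightarrow> (complex \<Rightarrow> complex) set" where
  "dirichlet_space p = {f. f holomorphic_on unit_disc \<and> dirichlet_energy p f < \<infinity>}"

definition dirichlet_norm :: "real \<Rightarrow> (complex \<Rightarrow> complex) \<Rightarrow> real" where
  "dirichlet_norm p f = enn2real (dirichlet_energy p f) powr (1 / p)"

definition T_op :: "(complex \<Rightarrow> complex) \<Rightarrow> (complex \<Rightarrow> complex) \<Rightarrow> complex \<Rightarrow> complex" where
  "T_op g f z = contour_integral (linepath 0 z) (\<lambda>\<zeta>. f \<zeta> * deriv g \<zeta>)"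

definition bounded_operator ::
  "(complex \<Rightarrow> complex) set \<Rightarrow> ((complex \<Rightarrow> complex) \<Rightarrow> real) \<Rightarrow>
   (complex \<Rightarrow> complex) set \<Rightarrow> ((complex \<Rightarrow> complex) \<Rightarrow> real) \<Rightarrow>
   ((complex \<Rightarrow> complex) \<Rightarrow> complex \<Rightarrow> complex) \<Rightarrow> bool" where
  "bounded_operator X normX Y normY T \<longleftrightarrow>
     (\<forall>f\<in>X. T f \<in> Y) \<and> (\<exists>C. \<forall>f\<in>X. normY (T f) \<le> C * normX f)"

definition arc_length :: "complex set \<Rightarrow> real" where
  "arc_length I = measure lborel {t \<in> {0..<2 * pi}. cis t \<in> I} / (2 * pi)"

definition carleson_square :: "complex set \<Rightarrow> complex set" where
  "carleson_square I = {of_real r * cis t | r t. cis t \<in> I \<and> 1 - arc_length I \<le> r \<and> r < 1}"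

definition centred_arc :: "complex \<Rightarrow> complex set" where
  "centred_arc a = {cis \<theta> | \<theta>. \<bar>Arg (a * cis (- \<theta>))\<bar> \<le> pi * (1 - norm a)}"

definition bmoa_energy :: "(complex \<Rightarrow> complex) \<Rightarrow> ennreal" where
  "bmoa_energy g =
     (SUP a\<in>unit_disc - {0}.
        (\<integral>\<^sup>+z\<in>carleson_square (centred_arc a).
           ennreal ((norm (deriv g z))\<^sup>2 * (1 - (norm z)\<^sup>2)) \<partial>disc_area) / ennreal (1 - norm a))
     + ennreal ((norm (g 0))\<^sup>2)"

definition BMOA :: "(complex \<Rightarrow> complex) set" where
  "BMOA = {g. g holomorphic_on unit_disc \<and> bmoa_energy g < \<infinity>}"

end

theory Submission
  imports Defs
begin

text \<open>
  Both parts compare an area integral of a derivative with sums of squares of Taylor coefficients, through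
  Parseval's identity and the Littlewood-Paley inequality (\<open>littlewood_paley\<close>). Bounds in \<open>H^p\<close> turn into bounds on squares
  through the trivial inequality \<open>|F|^2 b \<le> |F|^p + b\<close> for \<open>0 \<le> b \<le> 1\<close> and \<open>p > 2\<close> (\<open>square_mult_le_powr_add\<close>).

  For the first part fix \<open>a\<close> in the disc, put \<open>\<delta> = 1 - |a|\<close> and test the operator on \<open>h z = \<delta> / (1 - cnj a z)\<close>. The
  \<open>p\<close>-th power of its Dirichlet norm is \<open>O(\<delta>)\<close> (\<open>dirichlet_energy_test_fun\<close>), so the \<open>p\<close>-th power means of \<open>F = T_op g h\<close> are
  \<open>O(\<delta>)\<close>; this needs that the Hardy norm dominates every mean, that is, that the means increase with the radius
  (\<open>circle_mean_powr_mono\<close>). The means of \<open>|h|^2\<close> are \<open>O(\<delta>)\<close> too, hence so are those of \<open>|F h|^2 \<le> |F|^p + |h|^2\<close>. The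
  Littlewood-Paley inequality for \<open>F h\<close>, together with a direct estimate of \<open>F h'\<close>, shows that
  \<open>|F' h|^2 (1 - |z|^2)\<close> has area integral \<open>O(\<delta>)\<close> (\<open>localized_area_estimate\<close>). On the Carleson square of \<open>a\<close> the function \<open>h\<close> is
  bounded below, and \<open>F' h = g' h^2\<close>; therefore \<open>|g'|^2 (1 - |z|^2)\<close> has integral \<open>O(\<delta>)\<close> over the square, which is the condition for
  BMOA.

  For the second part take the lacunary series \<open>f = \<Sum>k. (k + 1)^(- 1/2) z^(2^k)\<close>. It lies in the Dirichlet-type space because
  the \<open>p\<close>-th powers of its coefficients are summable (\<open>lacunary_in_dirichlet_space\<close>), but the squares of the coefficients are not.
  The operator with symbol \<open>z^m\<close> multiplies the coefficient of order \<open>j\<close> by \<open>m / (m + j)\<close>, so for large \<open>m\<close> the image has large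
  square norm. The series \<open>g = \<Sum>k. 2^(-k) z^(N k)\<close> belongs to the disc algebra, and if \<open>N\<close> grows fast enough the coefficients of
  \<open>T_op g f\<close> are not square summable (\<open>exists_disc_algebra_symbol\<close>), while those of every function in \<open>H^p\<close> are.
\<close>

section \<open>Polar coordinates in the plane\<close>

lemma lborel_complex_eq_pair:
  "(lborel :: complex measure) = distr (lborel \<Otimes>\<^sub>M lborel) borel (\<lambda>(x, y). Complex x y)"
proof (rule lborel_eqI)
  fix l u :: complex assume le: "\<And>b. b \<in> Basis \<Longrightarrow> l \<bullet> b \<le> u \<bullet> b"
  have m: "(\<lambda>(x, y). Complex x y) \<in> borel_measurable (lborel \<Otimes>\<^sub>M lborel)"
    unfolding Complex_eq case_prod_beta by measurable
  have "(\<lambda>(x, y). Complex x y) -` box l u \<inter> space (lborel \<Otimes>\<^sub>M lborel) = {Re l<..<Re u} \<times> {Im l<..<Im u}"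
    by (auto simp: box_def Basis_complex_def space_pair_measure)
  moreover have "Re l \<le> Re u" "Im l \<le> Im u"
    using le[of 1] le[of \<i>] by (auto simp: Basis_complex_def)
  ultimately show "emeasure (distr (lborel \<Otimes>\<^sub>M lborel) borel (\<lambda>(x, y). Complex x y)) (box l u)
      = ennreal (prod ((\<bullet>) (u - l)) Basis)"
    by (subst emeasure_distr[OF m])
       (auto simp: lborel.emeasure_pair_measure_Times Basis_complex_def ennreal_mult')
qed simp

lemma nn_integral_complex_iterated:
  assumes [measurable]: "\<phi> \<in> borel_measurable (borel :: complex measure)"
  shows "integral\<^sup>N lborel \<phi> = (\<integral>\<^sup>+x. \<integral>\<^sup>+y. \<phi> (Complex x y) \<partial>lborel \<partial>lborel)"
proof -
  have m: "(\<lambda>(x, y). Complex x y) \<in> borel_measurable (lborel \<Otimes>\<^sub>M lborel)"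
    unfolding Complex_eq case_prod_beta by measurable
  have "integral\<^sup>N lborel \<phi> = (\<integral>\<^sup>+z. \<phi> ((\<lambda>(x, y). Complex x y) z) \<partial>(lborel \<Otimes>\<^sub>M lborel))"
    by (subst lborel_complex_eq_pair, subst nn_integral_distr[OF m]) auto
  also have "\<dots> = (\<integral>\<^sup>+x. \<integral>\<^sup>+y. \<phi> (Complex x y) \<partial>lborel \<partial>lborel)"
    using m by (subst lborel.nn_integral_fst[symmetric]) (auto intro: measurable_compose[OF _ assms])
  finally show ?thesis .
qed

text \<open>
  A quarter turn exchanges the two coordinates up to a sign, so Fubini and a reflection suffice. Together with the parametrisation of a single sector this replaces the rotation invariance of the plane measure.
\<close>

lemma nn_integral_quarter_turn:
  assumes [measurable]: "\<phi> \<in> borel_measurable (borel :: complex measure)"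
  shows "(\<integral>\<^sup>+z. \<phi> (\<i> * z) \<partial>lborel) = integral\<^sup>N lborel \<phi>"
proof -
  have [measurable]: "(\<lambda>p. Complex (fst p) (snd p)) \<in> borel_measurable (borel \<Otimes>\<^sub>M borel)"
    unfolding Complex_eq by measurable
  have [measurable]: "(\<lambda>y. Complex (- y) x) \<in> borel_measurable borel" "(\<lambda>y. Complex y x) \<in> borel_measurable borel" for x
    unfolding Complex_eq by measurable
  have "(\<integral>\<^sup>+z. \<phi> (\<i> * z) \<partial>lborel) = (\<integral>\<^sup>+x. \<integral>\<^sup>+y. \<phi> (\<i> * Complex x y) \<partial>lborel \<partial>lborel)"
    by (rule nn_integral_complex_iterated) measurable
  also have "\<dots> = (\<integral>\<^sup>+x. \<integral>\<^sup>+y. \<phi> (Complex (- y) x) \<partial>lborel \<partial>lborel)"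
    by (intro nn_integral_cong arg_cong[of _ _ \<phi>]) (auto simp: complex_eq_iff)
  also have "\<dots> = (\<integral>\<^sup>+x. \<integral>\<^sup>+y. \<phi> (Complex y x) \<partial>lborel \<partial>lborel)"
    using nn_integral_real_affine[where c="-1" and t=0 and f="\<lambda>y. \<phi> (Complex y x)" for x]
    by simp
  also have "\<dots> = (\<integral>\<^sup>+y. \<integral>\<^sup>+x. \<phi> (Complex y x) \<partial>lborel \<partial>lborel)"
    by (rule lborel_pair.Fubini') (simp add: case_prod_beta)
  also have "\<dots> = integral\<^sup>N lborel \<phi>"
    by (rule nn_integral_complex_iterated[symmetric]) measurable
  finally show ?thesis .
qed

text \<open>
  On the sector \<open>\<bar>Im z\<bar> \<le> Re z\<close> the change to polar coordinates splits into two one-dimensional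
  substitutions: \<open>y = x tan t\<close> for fixed \<open>x\<close>, then, after exchanging the integrals, \<open>x = r cos t\<close> for
  fixed \<open>t\<close>. The angle stays in a compact interval on which \<open>tan\<close> is smooth, so no improper substitution
  occurs.
\<close>

lemma nn_integral_sector_polar:
  assumes [measurable]: "\<phi> \<in> borel_measurable (borel :: complex measure)"
  shows "(\<integral>\<^sup>+z. \<phi> z * indicator {z. 0 < Re z \<and> \<bar>Im z\<bar> \<le> Re z} z \<partial>lborel) =
    (\<integral>\<^sup>+r. (\<integral>\<^sup>+t. \<phi> (of_real r * cis t) * indicator {-(pi/4)..pi/4} t \<partial>lborel) * ennreal r * indicator {0<..} r \<partial>lborel)"
proof -
  let ?J = "{-(pi/4)..pi/4}"
  have [measurable]: "cis \<in> borel_measurable borel"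
    by (intro borel_measurable_continuous_onI continuous_intros)
  have [measurable]: "(\<lambda>y. Complex x y) \<in> borel_measurable borel" for x
    unfolding Complex_eq by measurable
  have cos_pos: "cos t > 0" if "t \<in> ?J" for t
    using that pi_gt_zero by (intro cos_gt_zero_pi; simp only: atLeastAtMost_iff; linarith)
  have cos_nz: "cos t \<noteq> 0" if "- pi \<le> t * 4" "t * 4 \<le> pi" for t
    using cos_pos[of t] that by simp
  have inner: "(\<integral>\<^sup>+y. \<phi> (Complex x y) * indicator {z. 0 < Re z \<and> \<bar>Im z\<bar> \<le> Re z} (Complex x y) \<partial>lborel) =
      (\<integral>\<^sup>+t. \<phi> (of_real (x / cos t) * cis t) * ennreal (x / (cos t)\<^sup>2) * indicator ?J t * indicator {0<..} x \<partial>lborel)" for x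
  proof (cases "0 < x")
    case True
    have "(\<integral>\<^sup>+y. \<phi> (Complex x y) * indicator {z. 0 < Re z \<and> \<bar>Im z\<bar> \<le> Re z} (Complex x y) \<partial>lborel) =
      (\<integral>\<^sup>+y. \<phi> (Complex x y) * indicator {x * tan (-(pi/4))..x * tan (pi/4)} y \<partial>lborel)"
      using True by (intro nn_integral_cong) (auto simp: indicator_def tan_45)
    also have "\<dots> = (\<integral>\<^sup>+t. \<phi> (Complex x (x * tan t)) * ennreal (x / (cos t)\<^sup>2) * indicator ?J t \<partial>lborel)"
      using True cos_pos
      by (intro nn_integral_substitution_aux)
         (auto intro!: derivative_eq_intros continuous_intros simp: field_simps cos_nz)
    also have "\<dots> = (\<integral>\<^sup>+t. \<phi> (of_real (x / cos t) * cis t) * ennreal (x / (cos t)\<^sup>2) * indicator ?J t * indicator {0<..} x \<partial>lborel)"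
    proof (intro nn_integral_cong)
      fix t
      show "\<phi> (Complex x (x * tan t)) * ennreal (x / (cos t)\<^sup>2) * indicator ?J t
        = \<phi> (of_real (x / cos t) * cis t) * ennreal (x / (cos t)\<^sup>2) * indicator ?J t * indicator {0<..} x"
      proof (cases "t \<in> ?J")
        case t: True
        have "Complex x (x * tan t) = of_real (x / cos t) * cis t"
          using cos_pos[OF t] by (auto simp: complex_eq_iff tan_def)
        then show ?thesis using True by simp
      qed auto
    qed
    finally show ?thesis .
  qed (auto intro!: nn_integral_cong simp: indicator_def)
  have radial: "(\<integral>\<^sup>+x. \<phi> (of_real (x / cos t) * cis t) * ennreal (x / (cos t)\<^sup>2) * indicator ?J t * indicator {0<..} x \<partial>lborel) =
      (\<integral>\<^sup>+r. \<phi> (of_real r * cis t) * ennreal r * indicator {0<..} r * indicator ?J t \<partial>lborel)" for t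
  proof (cases "t \<in> ?J")
    case True
    note c = cos_pos[OF True]
    have "(\<integral>\<^sup>+x. \<phi> (of_real (x / cos t) * cis t) * ennreal (x / (cos t)\<^sup>2) * indicator ?J t * indicator {0<..} x \<partial>lborel)
      = ennreal \<bar>cos t\<bar> * (\<integral>\<^sup>+r. \<phi> (of_real ((0 + cos t * r) / cos t) * cis t) * ennreal ((0 + cos t * r) / (cos t)\<^sup>2) * indicator ?J t * indicator {0<..} (0 + cos t * r) \<partial>lborel)"
      using c by (intro nn_integral_real_affine) (measurable, auto simp: open_Collect_less)
    also have "\<dots> = (\<integral>\<^sup>+r. ennreal \<bar>cos t\<bar> * (\<phi> (of_real ((0 + cos t * r) / cos t) * cis t) * ennreal ((0 + cos t * r) / (cos t)\<^sup>2) * indicator ?J t * indicator {0<..} (0 + cos t * r)) \<partial>lborel)"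
      by (intro nn_integral_cmult[symmetric]) measurable
    also have "\<dots> = (\<integral>\<^sup>+r. \<phi> (of_real r * cis t) * ennreal r * indicator {0<..} r * indicator ?J t \<partial>lborel)"
    proof (intro nn_integral_cong)
      fix r
      have "ennreal r = ennreal \<bar>cos t\<bar> * ennreal (r / cos t)" if "r > 0"
        using c that by (subst ennreal_mult[symmetric]) auto
      moreover have "cos t * r / (cos t)\<^sup>2 = r / cos t"
        using c by (simp add: power2_eq_square)
      ultimately show "ennreal \<bar>cos t\<bar> * (\<phi> (of_real ((0 + cos t * r) / cos t) * cis t) * ennreal ((0 + cos t * r) / (cos t)\<^sup>2) * indicator ?J t * indicator {0<..} (0 + cos t * r))
        = \<phi> (of_real r * cis t) * ennreal r * indicator {0<..} r * indicator ?J t"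
        using c by (cases "r > 0") (auto simp: mult_ac indicator_def zero_less_mult_iff)
    qed
    finally show ?thesis .
  qed auto
  have "(\<integral>\<^sup>+z. \<phi> z * indicator {z. 0 < Re z \<and> \<bar>Im z\<bar> \<le> Re z} z \<partial>lborel) =
    (\<integral>\<^sup>+x. \<integral>\<^sup>+y. \<phi> (Complex x y) * indicator {z. 0 < Re z \<and> \<bar>Im z\<bar> \<le> Re z} (Complex x y) \<partial>lborel \<partial>lborel)"
    by (rule nn_integral_complex_iterated) measurable
  also have "\<dots> = (\<integral>\<^sup>+x. \<integral>\<^sup>+t. \<phi> (of_real (x / cos t) * cis t) * ennreal (x / (cos t)\<^sup>2) * indicator ?J t * indicator {0<..} x \<partial>lborel \<partial>lborel)"
    by (simp only: inner)
  also have "\<dots> = (\<integral>\<^sup>+t. \<integral>\<^sup>+x. \<phi> (of_real (x / cos t) * cis t) * ennreal (x / (cos t)\<^sup>2) * indicator ?J t * indicator {0<..} x \<partial>lborel \<partial>lborel)"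
    by (rule lborel_pair.Fubini'[symmetric]) measurable
  also have "\<dots> = (\<integral>\<^sup>+t. \<integral>\<^sup>+r. \<phi> (of_real r * cis t) * ennreal r * indicator {0<..} r * indicator ?J t \<partial>lborel \<partial>lborel)"
    by (simp only: radial)
  also have "\<dots> = (\<integral>\<^sup>+r. \<integral>\<^sup>+t. \<phi> (of_real r * cis t) * ennreal r * indicator {0<..} r * indicator ?J t \<partial>lborel \<partial>lborel)"
    by (rule lborel_pair.Fubini') measurable
  also have "\<dots> = (\<integral>\<^sup>+r. (\<integral>\<^sup>+t. \<phi> (of_real r * cis t) * indicator ?J t \<partial>lborel) * ennreal r * indicator {0<..} r \<partial>lborel)"
    by (intro nn_integral_cong, subst nn_integral_multc[symmetric], measurable,
        subst nn_integral_multc[symmetric], measurable)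
       (auto intro!: nn_integral_cong simp: mult_ac)
  finally show ?thesis .
qed

lemma nn_integral_shift:
  fixes u :: "real \<Rightarrow> ennreal"
  assumes [measurable]: "u \<in> borel_measurable borel"
  shows "(\<integral>\<^sup>+t. u (t + c) * indicator {a..b} t \<partial>lborel) = (\<integral>\<^sup>+t. u t * indicator {a + c..b + c} t \<partial>lborel)"
proof -
  have "(\<integral>\<^sup>+t. u t * indicator {a + c..b + c} t \<partial>lborel) = ennreal \<bar>1\<bar> * (\<integral>\<^sup>+t. u (c + 1 * t) * indicator {a + c..b + c} (c + 1 * t) \<partial>lborel)"
    by (rule nn_integral_real_affine) auto
  also have "\<dots> = (\<integral>\<^sup>+t. u (t + c) * indicator {a..b} t \<partial>lborel)"
    by (auto intro!: nn_integral_cong simp: indicator_def add_ac)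
  finally show ?thesis ..
qed

lemma nn_integral_interval_split:
  fixes u :: "real \<Rightarrow> ennreal"
  assumes [measurable]: "u \<in> borel_measurable borel" and "a \<le> b" "b \<le> c"
  shows "(\<integral>\<^sup>+t. u t * indicator {a..c} t \<partial>lborel) =
    (\<integral>\<^sup>+t. u t * indicator {a..b} t \<partial>lborel) + (\<integral>\<^sup>+t. u t * indicator {b..c} t \<partial>lborel)"
proof -
  have "(\<integral>\<^sup>+t. u t * indicator {a..c} t \<partial>lborel) = (\<integral>\<^sup>+t. u t * indicator {a..b} t + u t * indicator {b..c} t \<partial>lborel)"
    using AE_lborel_singleton[of b] assms(2,3)
    by (intro nn_integral_cong_AE) (auto simp: indicator_def elim!: eventually_mono)
  then show ?thesis by (simp add: nn_integral_add)
qed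

lemma nn_integral_period:
  fixes u :: "real \<Rightarrow> ennreal"
  assumes [measurable]: "u \<in> borel_measurable borel" and per: "\<And>t. u (t + c) = u t" and "0 \<le> a" "a \<le> c"
  shows "(\<integral>\<^sup>+t. u t * indicator {a..a + c} t \<partial>lborel) = (\<integral>\<^sup>+t. u t * indicator {0..c} t \<partial>lborel)"
proof -
  have "(\<integral>\<^sup>+t. u t * indicator {a..a + c} t \<partial>lborel) =
     (\<integral>\<^sup>+t. u t * indicator {a..c} t \<partial>lborel) + (\<integral>\<^sup>+t. u t * indicator {0 + c..a + c} t \<partial>lborel)"
    using assms(3,4) nn_integral_interval_split[OF assms(1), of a c "a+c"] by simp
  also have "(\<integral>\<^sup>+t. u t * indicator {0 + c..a + c} t \<partial>lborel) = (\<integral>\<^sup>+t. u t * indicator {0..a} t \<partial>lborel)"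
    by (subst nn_integral_shift[symmetric]) (auto simp: per)
  finally show ?thesis
    using nn_integral_interval_split[OF assms(1), of 0 a c] assms(3,4) by (simp add: add.commute)
qed

text \<open>
  Four rotated copies of the sector \<open>\<bar>Im z\<bar> \<le> Re z\<close> cover the punctured plane, and their angular ranges
  fill one period. Since the copies overlap along the diagonals the sum is estimated only from above; every area
  integral below is wanted from above.
\<close>

lemma nn_integral_polar_le:
  assumes [measurable]: "\<phi> \<in> borel_measurable (borel :: complex measure)"
  shows "integral\<^sup>N lborel \<phi> \<le>
    (\<integral>\<^sup>+r. (\<integral>\<^sup>+t. \<phi> (of_real r * cis t) * indicator {0..2*pi} t \<partial>lborel) * ennreal r * indicator {0<..} r \<partial>lborel)"
proof -
  let ?S = "{z. 0 < Re z \<and> \<bar>Im z\<bar> \<le> Re z}"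
  let ?J = "{-(pi/4)..pi/4}"
  have [measurable]: "cis \<in> borel_measurable borel"
    by (intro borel_measurable_continuous_onI continuous_intros)
  \<comment> \<open>Every nonzero point is brought into the sector by one of four quarter turns.\<close>
  have cover: "\<phi> z \<le> (\<Sum>k<4. \<phi> z * indicator ?S ((-\<i>)^k * z))" if z0: "z \<noteq> 0" for z
  proof -
    have "\<exists>k<4. (-\<i>)^k * z \<in> ?S"
    proof -
      consider "0 < Re z" "\<bar>Im z\<bar> \<le> Re z" | "0 < Im z" "\<bar>Re z\<bar> \<le> Im z"
        | "0 < - Re z" "\<bar>Im z\<bar> \<le> - Re z" | "0 < - Im z" "\<bar>Re z\<bar> \<le> - Im z"
        using z0 unfolding complex_eq_iff zero_complex.sel by argo
      then show ?thesis
      proof cases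
        case 1 then show ?thesis by (intro exI[of _ 0]) auto
      next
        case 2 then show ?thesis by (intro exI[of _ 1]) auto
      next
        case 3 then show ?thesis by (intro exI[of _ 2]) auto
      next
        case 4 then show ?thesis by (intro exI[of _ 3]) (auto simp: power3_eq_cube)
      qed
    qed
    then obtain k where k: "k < 4" "(-\<i>)^k * z \<in> ?S" by blast
    then have "\<phi> z = \<phi> z * indicator ?S ((-\<i>)^k * z)" by simp
    also have "\<dots> \<le> (\<Sum>k<4. \<phi> z * indicator ?S ((-\<i>)^k * z))"
      using k(1) by (intro member_le_sum) auto
    finally show ?thesis .
  qed
  have rot: "(\<integral>\<^sup>+z. \<phi> z * indicator ?S ((-\<i>)^k * z) \<partial>lborel) = (\<integral>\<^sup>+z. \<phi> (\<i>^k * z) * indicator ?S z \<partial>lborel)" for k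
  proof (induction k)
    case (Suc k)
    have "(\<integral>\<^sup>+z. \<psi> (\<i>^k * z) \<partial>lborel) = integral\<^sup>N lborel \<psi>" if [measurable]: "\<psi> \<in> borel_measurable borel" for \<psi> :: "complex \<Rightarrow> ennreal" and k
    proof (induction k)
      case (Suc k)
      then show ?case using nn_integral_quarter_turn[of "\<lambda>z. \<psi> (\<i>^k * z)"] by (simp add: mult_ac)
    qed simp
    note this[of "\<lambda>z. \<phi> z * indicator ?S ((-\<i>)^Suc k * z)" "Suc k"]
    moreover have "(-\<i>)^Suc k * (\<i>^Suc k * z) = z" for z
      by (simp add: mult.assoc[symmetric] power_mult_distrib[symmetric] del: power_Suc)
    ultimately show ?case by (simp del: power_Suc)
  qed simp
  have sector: "(\<integral>\<^sup>+z. \<phi> (\<i>^k * z) * indicator ?S z \<partial>lborel) =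
    (\<integral>\<^sup>+r. (\<integral>\<^sup>+t. \<phi> (of_real r * cis t) * indicator {-(pi/4) + k * (pi/2)..pi/4 + k * (pi/2)} t \<partial>lborel) * ennreal r * indicator {0<..} r \<partial>lborel)" for k
  proof -
    have "\<i>^k * (of_real r * cis t) = of_real r * cis (t + k * (pi/2))" for r t
      by (simp add: cis_mult[symmetric] cis_pi_half[symmetric] Complex.DeMoivre mult_ac del: cis_pi_half)
    note eq = this
    have "(\<integral>\<^sup>+t. \<phi> (\<i>^k * (of_real r * cis t)) * indicator ?J t \<partial>lborel) =
        (\<integral>\<^sup>+t. \<phi> (of_real r * cis t) * indicator {-(pi/4) + k * (pi/2)..pi/4 + k * (pi/2)} t \<partial>lborel)" for r
      unfolding eq by (rule nn_integral_shift) measurable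
    then show ?thesis
      using nn_integral_sector_polar[of "\<lambda>z. \<phi> (\<i>^k * z)"] by simp
  qed
  have circ: "(\<Sum>k<4. (\<integral>\<^sup>+t. \<phi> (of_real r * cis t) * indicator {-(pi/4) + real k * (pi/2)..pi/4 + real k * (pi/2)} t \<partial>lborel)) =
    (\<integral>\<^sup>+t. \<phi> (of_real r * cis t) * indicator {0..2*pi} t \<partial>lborel)" (is "?L = _") for r
  proof -
    let ?u = "\<lambda>t. \<phi> (of_real r * cis t)"
    have per: "?u (t + 2*pi) = ?u t" for t by (simp add: cis_mult[symmetric])
    have m: "?u \<in> borel_measurable borel" by measurable
    have "?L = (\<integral>\<^sup>+t. ?u t * indicator {-(pi/4)..7*pi/4} t \<partial>lborel)"
      using nn_integral_interval_split[OF m, of "-(pi/4)" "pi/4" "7*pi/4"] nn_integral_interval_split[OF m, of "pi/4" "3*pi/4" "7*pi/4"]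
        nn_integral_interval_split[OF m, of "3*pi/4" "5*pi/4" "7*pi/4"]
      by (simp add: eval_nat_numeral add.assoc field_simps)
    \<comment> \<open>The union of the four angular ranges starts at a negative angle; one period later it has a start in \<open>[0, 2 pi]\<close>.\<close>
    also have "\<dots> = (\<integral>\<^sup>+t. ?u t * indicator {7*pi/4..7*pi/4+2*pi} t \<partial>lborel)"
      using nn_integral_shift[OF m, of "2*pi" "-(pi/4)" "7*pi/4"] per by (simp add: field_simps)
    also have "\<dots> = (\<integral>\<^sup>+t. ?u t * indicator {0..2*pi} t \<partial>lborel)"
      using per by (intro nn_integral_period) auto
    finally show ?thesis .
  qed
  have "integral\<^sup>N lborel \<phi> \<le> (\<integral>\<^sup>+z. (\<Sum>k<4. \<phi> z * indicator ?S ((-\<i>)^k * z)) \<partial>lborel)"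
    using AE_lborel_singleton[of "0::complex"]
    by (intro nn_integral_mono_AE) (erule eventually_mono, rule cover, simp)
  also have "\<dots> = (\<Sum>k<4. (\<integral>\<^sup>+z. \<phi> z * indicator ?S ((-\<i>)^k * z) \<partial>lborel))"
    by (rule nn_integral_sum) measurable
  also have "\<dots> = (\<integral>\<^sup>+r. (\<Sum>k<4. (\<integral>\<^sup>+t. \<phi> (of_real r * cis t) * indicator {-(pi/4) + real k * (pi/2)..pi/4 + real k * (pi/2)} t \<partial>lborel) * ennreal r * indicator {0<..} r) \<partial>lborel)"
    unfolding rot sector by (rule nn_integral_sum[symmetric]) measurable
  finally show ?thesis
    by (simp only: sum_distrib_right[symmetric] circ)
qed

section \<open>Circle means\<close>

definition circle_mean :: "(complex \<Rightarrow> real) \<Rightarrow> real \<Rightarrow> real" where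
  "circle_mean u r = 1 / (2 * pi) * integral {0..2 * pi} (\<lambda>t. u (of_real r * cis t))"

lemma continuous_on_circle:
  assumes "continuous_on unit_disc u" "0 \<le> r" "r < 1"
  shows "continuous_on S (\<lambda>t. u (of_real r * cis t))"
  by (rule continuous_on_compose2[OF assms(1)]) (use assms in \<open>auto intro!: continuous_intros simp: norm_mult\<close>)

lemma circle_integrable:
  fixes u :: "complex \<Rightarrow> real"
  assumes "continuous_on unit_disc u" "0 \<le> r" "r < 1"
  shows "(\<lambda>t. u (of_real r * cis t)) integrable_on {0..2 * pi}"
  by (intro integrable_continuous_interval continuous_on_circle assms)

lemma circle_mean_mono:
  assumes "continuous_on unit_disc u" "continuous_on unit_disc v" "0 \<le> r" "r < 1"
    and "\<And>z. norm z = r \<Longrightarrow> u z \<le> v z"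
  shows "circle_mean u r \<le> circle_mean v r"
  unfolding circle_mean_def
  by (intro mult_left_mono integral_le circle_integrable) (use assms in \<open>auto simp: norm_mult\<close>)

lemma circle_mean_add:
  assumes "continuous_on unit_disc u" "continuous_on unit_disc v" "0 \<le> r" "r < 1"
  shows "circle_mean (\<lambda>z. u z + v z) r = circle_mean u r + circle_mean v r"
  unfolding circle_mean_def
  by (subst Henstock_Kurzweil_Integration.integral_add[OF circle_integrable circle_integrable])
     (use assms in \<open>auto simp: algebra_simps\<close>)

lemma circle_mean_cmult: "circle_mean (\<lambda>z. c * u z) r = c * circle_mean u r"
  by (simp add: circle_mean_def)

lemma circle_mean_nonneg:
  assumes "continuous_on unit_disc u" "0 \<le> r" "r < 1" "\<And>z. norm z = r \<Longrightarrow> 0 \<le> u z"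
  shows "0 \<le> circle_mean u r"
  unfolding circle_mean_def
  by (intro mult_nonneg_nonneg integral_nonneg circle_integrable) (use assms in \<open>auto simp: norm_mult\<close>)

lemma circle_mean_cong:
  assumes "\<And>z. norm z = r \<Longrightarrow> u z = v z" "0 \<le> r"
  shows "circle_mean u r = circle_mean v r"
  unfolding circle_mean_def using assms by (simp add: norm_mult)

lemma nn_integral_circle:
  assumes "continuous_on unit_disc u" "0 \<le> r" "r < 1" "\<And>z. norm z = r \<Longrightarrow> 0 \<le> u z"
  shows "(\<integral>\<^sup>+t. ennreal (u (of_real r * cis t)) * indicator {0..2*pi} t \<partial>lborel) = ennreal (2 * pi * circle_mean u r)"
proof -
  have c: "continuous_on {0..2*pi} (\<lambda>t. u (of_real r * cis t))"
    by (intro continuous_on_circle assms)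
  have "(\<integral>\<^sup>+t. ennreal (u (of_real r * cis t)) * indicator {0..2*pi} t \<partial>lborel) = ennreal (integral {0..2*pi} (\<lambda>t. u (of_real r * cis t)))"
  proof (rule set_nn_integral_lborel_eq_integral)
    show "set_borel_measurable borel {0..2 * pi} (\<lambda>x. u (of_real r * cis x))"
      unfolding set_borel_measurable_def
      using borel_measurable_continuous_on_indicator[OF _ c] by simp
    obtain B where B: "\<And>t. t \<in> {0..2*pi} \<Longrightarrow> u (of_real r * cis t) \<le> B"
      using continuous_attains_sup[OF _ _ c] by fastforce
    have "(\<integral>\<^sup>+t\<in>{0..2*pi}. ennreal (u (of_real r * cis t)) \<partial>lborel) \<le> (\<integral>\<^sup>+t\<in>{0..2*pi}. ennreal B \<partial>lborel)"
      by (intro nn_integral_mono) (auto simp: indicator_def intro!: ennreal_leI B)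
    also have "\<dots> < \<infinity>" by (simp add: nn_integral_cmult_indicator ennreal_mult_less_top)
    finally show "(\<integral>\<^sup>+t\<in>{0..2*pi}. ennreal (u (of_real r * cis t)) \<partial>lborel) < \<infinity>" .
  qed (use assms in \<open>auto simp: norm_mult\<close>)
  then show ?thesis by (simp add: circle_mean_def)
qed

lemma circle_mean_rotate:
  assumes u: "continuous_on unit_disc u" "\<And>z. z \<in> unit_disc \<Longrightarrow> 0 \<le> u z" and r: "0 \<le> r" "r < 1"
  shows "circle_mean (\<lambda>z. u (cis s * z)) r = circle_mean u r"
proof -
  obtain a where a: "0 \<le> a" "a < 2 * pi" "cis s = cis a"
    using Arg2pi[of "cis s"] by (auto simp: cis_conv_exp is_Arg_def)
  let ?w = "\<lambda>t. ennreal (u (of_real r * cis t))"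
  have "continuous_on UNIV (\<lambda>t. u (of_real r * cis t))"
    by (intro continuous_on_circle u r)
  then have m: "?w \<in> borel_measurable borel"
    by (intro measurable_compose[OF borel_measurable_continuous_onI measurable_ennreal])
  have u': "continuous_on unit_disc (\<lambda>z. u (cis s * z))"
    by (rule continuous_on_compose2[OF u(1)]) (auto intro!: continuous_intros simp: norm_mult)
  have "ennreal (2 * pi * circle_mean (\<lambda>z. u (cis s * z)) r) = (\<integral>\<^sup>+t. ?w (t + a) * indicator {0..2*pi} t \<partial>lborel)"
    by (subst nn_integral_circle[OF u' r, symmetric])
       (use u r a in \<open>auto intro!: nn_integral_cong simp: norm_mult cis_mult[symmetric] mult_ac\<close>)
  also have "\<dots> = (\<integral>\<^sup>+t. ?w t * indicator {a..a+2*pi} t \<partial>lborel)"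
    using nn_integral_shift[OF m, of a 0 "2*pi"] by (simp add: add_ac)
  also have "\<dots> = (\<integral>\<^sup>+t. ?w t * indicator {0..2*pi} t \<partial>lborel)"
    using a by (intro nn_integral_period[OF m]) (auto simp: cis_mult[symmetric])
  also have "\<dots> = ennreal (2 * pi * circle_mean u r)"
    using u r by (intro nn_integral_circle) auto
  finally have "2 * pi * circle_mean (\<lambda>z. u (cis s * z)) r = 2 * pi * circle_mean u r"
    by (subst (asm) ennreal_inj) (use u u' r in \<open>auto intro!: mult_nonneg_nonneg circle_mean_nonneg simp: norm_mult\<close>)
  then show ?thesis by simp
qed

lemma sets_disc_area [simp, measurable_cong]: "sets disc_area = sets borel"
  by (simp add: disc_area_def)

lemma disc_measurable:
  assumes "continuous_on unit_disc u"
  shows "(\<lambda>z. ennreal (u z) * indicator unit_disc z) \<in> borel_measurable borel"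
proof -
  have "(\<lambda>z. indicator unit_disc z *\<^sub>R u z) \<in> borel_measurable borel"
    by (rule borel_measurable_continuous_on_indicator) (use assms in auto)
  then have "(\<lambda>z. ennreal (indicator unit_disc z *\<^sub>R u z)) \<in> borel_measurable borel"
    by (rule measurable_compose) simp
  moreover have eq: "(\<lambda>z. ennreal (indicator unit_disc z *\<^sub>R u z)) = (\<lambda>z. ennreal (u z) * indicator unit_disc z)"
    by (auto simp: indicator_def)
  ultimately show ?thesis by simp
qed

lemma nn_integral_disc_area_mono:
  assumes "\<And>z. z \<in> unit_disc \<Longrightarrow> u z \<le> v z"
  shows "(\<integral>\<^sup>+z\<in>unit_disc. ennreal (u z) \<partial>disc_area) \<le> (\<integral>\<^sup>+z\<in>unit_disc. ennreal (v z) \<partial>disc_area)"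
  by (intro nn_integral_mono) (auto simp: indicator_def intro!: ennreal_leI assms)

text \<open>
  Polar coordinates with the normalisation \<open>dA = dx dy / pi\<close>, which turns the Jacobian into \<open>2 r\<close>.
\<close>

lemma nn_integral_disc_le:
  assumes "continuous_on unit_disc u" "\<And>z. z \<in> unit_disc \<Longrightarrow> 0 \<le> u z"
    and v: "\<And>r. 0 < r \<Longrightarrow> r < 1 \<Longrightarrow> 2 * r * circle_mean u r \<le> v r"
  shows "(\<integral>\<^sup>+z\<in>unit_disc. ennreal (u z) \<partial>disc_area) \<le> (\<integral>\<^sup>+r\<in>{0<..<1}. ennreal (v r) \<partial>lborel)"
proof -
  note m = disc_measurable[OF assms(1)]
  let ?u = "\<lambda>z. u z / pi"
  have u': "continuous_on unit_disc ?u" by (intro continuous_intros assms) auto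
  have mean: "circle_mean ?u r = circle_mean u r / pi" for r
    using circle_mean_cmult[of "1/pi" u r] by simp
  have eq': "ennreal (1/pi) * (ennreal (u z) * indicator unit_disc z) = ennreal (?u z) * indicator unit_disc z" for z
    using assms(2)[of z] by (auto simp: indicator_def ennreal_mult[symmetric])
  have "(\<integral>\<^sup>+z\<in>unit_disc. ennreal (u z) \<partial>disc_area) = ennreal (1/pi) * (\<integral>\<^sup>+z\<in>unit_disc. ennreal (u z) \<partial>lborel)"
    unfolding disc_area_def using m by (subst nn_integral_scale_measure) auto
  also have "\<dots> = (\<integral>\<^sup>+z. ennreal (?u z) * indicator unit_disc z \<partial>lborel)"
    using m by (subst nn_integral_cmult[symmetric]) (auto simp: eq')
  also have "\<dots> \<le> (\<integral>\<^sup>+r. (\<integral>\<^sup>+t. ennreal (?u (of_real r * cis t)) * indicator unit_disc (of_real r * cis t) * indicator {0..2*pi} t \<partial>lborel) * ennreal r * indicator {0<..} r \<partial>lborel)"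
    using m by (intro nn_integral_polar_le) (auto simp: eq'[symmetric])
  also have "\<dots> \<le> (\<integral>\<^sup>+r. ennreal (v r) * indicator {0<..<1} r \<partial>lborel)"
  proof (intro nn_integral_mono)
    fix r :: real
    show "(\<integral>\<^sup>+t. ennreal (?u (of_real r * cis t)) * indicator unit_disc (of_real r * cis t) * indicator {0..2*pi} t \<partial>lborel) * ennreal r * indicator {0<..} r
       \<le> ennreal (v r) * indicator {0<..<1} r"
    proof (cases "0 < r \<and> r < 1")
      case True
      then have "(\<integral>\<^sup>+t. ennreal (?u (of_real r * cis t)) * indicator unit_disc (of_real r * cis t) * indicator {0..2*pi} t \<partial>lborel)
         = ennreal (2 * pi * circle_mean ?u r)"
        using assms by (subst nn_integral_circle[OF u', symmetric]) (auto intro!: nn_integral_cong simp: norm_mult)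
      also have "\<dots> * ennreal r = ennreal (2 * pi * circle_mean ?u r * r)"
        using True by (simp add: ennreal_mult'')
      also have "\<dots> \<le> ennreal (v r)"
        using v[of r] True by (intro ennreal_leI) (simp add: mult_ac mean)
      finally show ?thesis using True by simp
    next
      case False
      then have "(\<integral>\<^sup>+t. ennreal (?u (of_real r * cis t)) * indicator unit_disc (of_real r * cis t) * indicator {0..2*pi} t \<partial>lborel) * indicator {0<..} r = 0"
        by (cases "0 < r") (auto simp: norm_mult)
      then show ?thesis by (metis (no_types, lifting) mult.assoc mult.commute mult_zero_left zero_le)
    qed
  qed
  finally show ?thesis .
qed

text \<open>
  The factor \<open>r\<close> of the Jacobian matters for the constant in the Littlewood-Paley inequality; for rough estimates it is bounded by one.
\<close>

lemma nn_integral_disc_le_radial: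
  assumes u: "continuous_on unit_disc u" "\<And>z. z \<in> unit_disc \<Longrightarrow> 0 \<le> u z"
    and v: "\<And>r. 0 < r \<Longrightarrow> r < 1 \<Longrightarrow> circle_mean u r \<le> v r"
  shows "(\<integral>\<^sup>+z\<in>unit_disc. ennreal (u z) \<partial>disc_area) \<le> (\<integral>\<^sup>+r\<in>{0<..<1}. ennreal (2 * v r) \<partial>lborel)"
proof (rule nn_integral_disc_le[OF u])
  fix r :: real assume r: "0 < r" "r < 1"
  have "0 \<le> circle_mean u r" using r by (intro circle_mean_nonneg u) auto
  then have "r * circle_mean u r \<le> 1 * v r" using r by (intro mult_mono v) auto
  then show "2 * r * circle_mean u r \<le> 2 * v r" by simp
qed

lemma nn_integral_unit_interval_FTC:
  assumes "\<And>r::real. 0 \<le> r \<Longrightarrow> r \<le> 1 \<Longrightarrow> (F has_real_derivative f r) (at r)"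
    "\<And>r. 0 \<le> r \<Longrightarrow> r \<le> 1 \<Longrightarrow> 0 \<le> f r" "f \<in> borel_measurable borel"
  shows "(\<integral>\<^sup>+r\<in>{0<..<1}. ennreal (f r) \<partial>lborel) \<le> ennreal (F 1 - F 0)"
proof -
  have "(\<integral>\<^sup>+r\<in>{0<..<1}. ennreal (f r) \<partial>lborel) \<le> (\<integral>\<^sup>+r\<in>{0..1}. ennreal (f r) \<partial>lborel)"
    by (intro nn_integral_mono) (auto simp: indicator_def)
  also have "\<dots> = ennreal (F 1 - F 0)"
    by (rule nn_integral_FTC_Icc) (use assms in auto)
  finally show ?thesis .
qed

section \<open>Taylor coefficients and Parseval's identity\<close>

definition taylor_coeff :: "(complex \<Rightarrow> complex) \<Rightarrow> nat \<Rightarrow> complex" where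
  "taylor_coeff f n = (deriv ^^ n) f 0 / fact n"

lemma taylor_sums:
  assumes "f holomorphic_on unit_disc" "z \<in> unit_disc"
  shows "(\<lambda>n. taylor_coeff f n * z ^ n) sums f z"
  using holomorphic_power_series[OF assms] by (simp add: taylor_coeff_def)

lemma taylor_coeff_eqI:
  assumes "\<And>z. z \<in> unit_disc \<Longrightarrow> (\<lambda>n. c n * z ^ n) sums f z"
  shows "taylor_coeff f n = c n"
proof -
  have "conv_radius c \<ge> 1"
  proof (rule conv_radius_geI_ex)
    fix r :: real assume "0 < r" "ereal r < 1"
    then show "\<exists>z. norm z = r \<and> summable (\<lambda>n. c n * z ^ n)"
      using assms[of "of_real r"] by (intro exI[of _ "of_real r"]) (auto simp: sums_iff)
  qed
  then have r: "fps_conv_radius (Abs_fps c) \<ge> 1" by (simp add: fps_conv_radius_def)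
  have "f has_fps_expansion Abs_fps c"
    unfolding has_fps_expansion_def
  proof
    show "fps_conv_radius (Abs_fps c) > 0" using r by (rule less_le_trans[rotated]) simp
    have "eventually (\<lambda>z. z \<in> unit_disc) (nhds (0::complex))" by (intro eventually_nhds_in_open) auto
    then show "eventually (\<lambda>z. eval_fps (Abs_fps c) z = f z) (nhds 0)"
      by eventually_elim (use assms in \<open>auto simp: eval_fps_def sums_iff\<close>)
  qed
  from fps_nth_fps_expansion[OF this, of n] show ?thesis by (simp add: taylor_coeff_def)
qed

lemma taylor_coeff_deriv: "taylor_coeff (deriv f) n = of_nat (Suc n) * taylor_coeff f (Suc n)"
  by (simp add: taylor_coeff_def funpow_swap1 field_simps del: of_nat_Suc)

lemma taylor_coeff_cong:
  assumes "f holomorphic_on unit_disc" "g holomorphic_on unit_disc" "\<And>z. z \<in> unit_disc \<Longrightarrow> f z = g z"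
  shows "taylor_coeff f n = taylor_coeff g n"
  unfolding taylor_coeff_def using higher_deriv_transform_within_open[OF assms(1,2) open_ball _ assms(3)] by simp

lemma taylor_coeff_mult:
  assumes "f holomorphic_on unit_disc" "g holomorphic_on unit_disc"
  shows "taylor_coeff (\<lambda>z. f z * g z) n = (\<Sum>i\<le>n. taylor_coeff f i * taylor_coeff g (n - i))"
  unfolding taylor_coeff_def
  by (subst higher_deriv_mult[OF assms open_ball])
     (auto simp: sum_divide_distrib binomial_fact atLeast0AtMost intro!: sum.cong)

lemma has_integral_cis:
  "((\<lambda>t. cis (of_int k * t)) has_integral (if k = 0 then of_real (2 * pi) else 0)) {0..2*pi}"
proof (cases "k = 0")
  case True
  then show ?thesis using has_integral_const_real[of "1::complex" 0 "2*pi"] by (simp add: scaleR_conv_of_real)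
next
  case False
  have "((\<lambda>t. cis (of_int k * t)) has_integral (cis (of_int k * (2*pi)) / (\<i> * of_int k) - cis (of_int k * 0) / (\<i> * of_int k))) {0..2*pi}"
  proof (rule fundamental_theorem_of_calculus)
    fix t assume "t \<in> {0..2*pi}"
    have "((\<lambda>t. exp (\<i> * of_int k * of_real t) / (\<i> * of_int k)) has_vector_derivative exp (\<i> * of_int k * of_real t)) (at t within {0..2*pi})"
      by (rule has_vector_derivative_real_field) (use False in \<open>auto intro!: derivative_eq_intros\<close>)
    then show "((\<lambda>t. cis (of_int k * t) / (\<i> * of_int k)) has_vector_derivative cis (of_int k * t)) (at t within {0..2*pi})"
      by (simp add: cis_conv_exp mult_ac)
  qed auto
  moreover have "cis (of_int k * (2*pi)) = 1"
    using cos_int_2pin[of k] sin_int_2pin[of k] by (simp add: complex_eq_iff mult_ac)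
  ultimately show ?thesis using False by simp
qed

lemma integral_trig_poly:
  "((\<lambda>t. (norm (\<Sum>n<N. a n * cis (of_nat n * t)))\<^sup>2) has_integral (2 * pi * (\<Sum>n<N. (norm (a n))\<^sup>2))) {0..2*pi}"
proof -
  let ?S = "\<lambda>t. \<Sum>n<N. a n * cis (of_nat n * t)"
  have "of_real ((norm (?S t))\<^sup>2) = (\<Sum>n<N. \<Sum>m<N. a n * cnj (a m) * cis (of_int (int n - int m) * t))" for t
  proof -
    have "of_real ((norm (?S t))\<^sup>2) = ?S t * cnj (?S t)" by (simp only: complex_norm_square)
    also have "\<dots> = (\<Sum>n<N. \<Sum>m<N. (a n * cis (of_nat n * t)) * (cnj (a m) * cis (- (of_nat m * t))))"
      by (simp add: sum_product cis_cnj)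
    also have "\<dots> = (\<Sum>n<N. \<Sum>m<N. a n * cnj (a m) * (cis (of_nat n * t) * cis (- (of_nat m * t))))"
      by (simp add: mult_ac)
    finally show ?thesis by (simp add: cis_mult algebra_simps)
  qed
  moreover have "((\<lambda>t. \<Sum>n<N. \<Sum>m<N. a n * cnj (a m) * cis (of_int (int n - int m) * t)) has_integral
      (\<Sum>n<N. \<Sum>m<N. a n * cnj (a m) * (if int n - int m = 0 then of_real (2*pi) else 0))) {0..2*pi}"
    by (intro has_integral_sum has_integral_mult_right has_integral_cis finite_lessThan)
  moreover have "(\<Sum>n<N. \<Sum>m<N. a n * cnj (a m) * (if int n - int m = 0 then of_real (2*pi) else 0)) = of_real (2 * pi * (\<Sum>n<N. (norm (a n))\<^sup>2))"
  proof -
    have "(\<Sum>m<N. a n * cnj (a m) * (if int n - int m = 0 then of_real (2*pi) else 0)) = of_real (2 * pi * (norm (a n))\<^sup>2)" if "n < N" for n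
    proof -
      have "(\<Sum>m<N. a n * cnj (a m) * (if int n - int m = 0 then of_real (2*pi) else 0)) = (\<Sum>m<N. if m = n then a n * cnj (a n) * of_real (2*pi) else 0)"
        by (intro sum.cong) auto
      also have "\<dots> = of_real (2 * pi * (norm (a n))\<^sup>2)" using that
        by (simp add: complex_norm_square[symmetric] del: of_real_power)
      finally show ?thesis .
    qed
    then show ?thesis by (simp add: sum_distrib_left)
  qed
  ultimately have "((\<lambda>t. complex_of_real ((norm (?S t))\<^sup>2)) has_integral of_real (2 * pi * (\<Sum>n<N. (norm (a n))\<^sup>2))) {0..2*pi}"
    by simp
  from has_integral_Re[OF this] show ?thesis by (simp only: Re_complex_of_real)
qed

text \<open>
  The identity holds for the partial sums by orthogonality. They converge on the circle and are bounded there
  by \<open>\<Sum>n. |c n| r^n\<close>, so dominated convergence passes to the limit.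
\<close>

lemma parseval:
  assumes f: "f holomorphic_on unit_disc" and r: "0 \<le> r" "r < 1"
  shows "(\<lambda>n. (norm (taylor_coeff f n))\<^sup>2 * r ^ (2 * n)) sums circle_mean (\<lambda>z. (norm (f z))\<^sup>2) r"
proof -
  define a where "a n = taylor_coeff f n * of_real r ^ n" for n
  let ?S = "\<lambda>N t. \<Sum>n<N. a n * cis (of_nat n * t)"
  have lim: "(\<lambda>N. ?S N t) \<longlonglongrightarrow> f (of_real r * cis t)" for t
    using taylor_sums[OF f, of "of_real r * cis t"] r
    by (simp add: sums_def a_def norm_mult power_mult_distrib Complex.DeMoivre mult.assoc)
  obtain \<rho> where \<rho>: "r < \<rho>" "\<rho> < 1" using dense r by blast
  have "summable (\<lambda>n. norm (taylor_coeff f n * of_real r ^ n))"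
    by (rule powser_insidea[of _ "of_real \<rho>"]) (use taylor_sums[OF f, of "of_real \<rho>"] \<rho> r in \<open>auto simp: sums_iff\<close>)
  then have sm: "summable (\<lambda>n. norm (a n))" by (simp add: a_def)
  define M where "M = (\<Sum>n. norm (a n))"
  have bd: "norm (?S N t) \<le> M" for N t
  proof -
    have "norm (?S N t) \<le> (\<Sum>n<N. norm (a n))" by (rule order_trans[OF norm_sum]) (simp add: norm_mult)
    also have "\<dots> \<le> M" unfolding M_def by (rule sum_le_suminf[OF sm]) auto
    finally show ?thesis .
  qed
  have "(\<lambda>N. integral {0..2*pi} (\<lambda>t. (norm (?S N t))\<^sup>2)) \<longlonglongrightarrow> integral {0..2*pi} (\<lambda>t. (norm (f (of_real r * cis t)))\<^sup>2)"
  proof (rule dominated_convergence(2))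
    show "(\<lambda>t. (norm (?S N t))\<^sup>2) integrable_on {0..2*pi}" for N using integral_trig_poly[where N=N and a=a] by blast
    show "(\<lambda>t. M\<^sup>2) integrable_on {0..2*pi}" by (rule integrable_const_ivl)
    show "norm ((norm (?S N t))\<^sup>2) \<le> M\<^sup>2" for N t using bd[where N=N and t=t] by (simp add: power_mono)
    show "(\<lambda>N. (norm (?S N t))\<^sup>2) \<longlonglongrightarrow> (norm (f (of_real r * cis t)))\<^sup>2" for t
      by (intro tendsto_intros lim)
  qed
  then have "(\<lambda>N. 1/(2*pi) * (2 * pi * (\<Sum>n<N. (norm (a n))\<^sup>2))) \<longlonglongrightarrow> circle_mean (\<lambda>z. (norm (f z))\<^sup>2) r"
    unfolding circle_mean_def integral_unique[OF integral_trig_poly] by (intro tendsto_intros)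
  moreover have "(norm (a n))\<^sup>2 = (norm (taylor_coeff f n))\<^sup>2 * r ^ (2 * n)" for n
    using r by (simp add: a_def norm_mult norm_power power_mult_distrib power_even_eq)
  ultimately show ?thesis by (simp add: sums_def)
qed

lemma bessel:
  assumes f: "f holomorphic_on unit_disc" and K: "\<And>r. 0 < r \<Longrightarrow> r < 1 \<Longrightarrow> circle_mean (\<lambda>z. (norm (f z))\<^sup>2) r \<le> K"
  shows "(\<Sum>n<N. (norm (taylor_coeff f n))\<^sup>2) \<le> K"
proof -
  have "((\<lambda>r. \<Sum>n<N. (norm (taylor_coeff f n))\<^sup>2 * r ^ (2 * n)) \<longlongrightarrow> (\<Sum>n<N. (norm (taylor_coeff f n))\<^sup>2 * 1 ^ (2 * n))) (at_left (1::real))"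
    by (intro tendsto_intros)
  moreover have "eventually (\<lambda>r. (\<Sum>n<N. (norm (taylor_coeff f n))\<^sup>2 * r ^ (2 * n)) \<le> K) (at_left (1::real))"
  proof -
    have "(\<Sum>n<N. (norm (taylor_coeff f n))\<^sup>2 * r ^ (2 * n)) \<le> K" if "0 < r" "r < 1" for r
    proof -
      note p = parseval[OF f, of r]
      have "(\<Sum>n<N. (norm (taylor_coeff f n))\<^sup>2 * r ^ (2 * n)) \<le> (\<Sum>n. (norm (taylor_coeff f n))\<^sup>2 * r ^ (2 * n))"
        using p that by (intro sum_le_suminf) (auto simp: sums_iff)
      also have "\<dots> \<le> K" using p K that by (simp add: sums_iff)
      finally show ?thesis .
    qed
    then show ?thesis using eventually_at_left_real[of 0 "1::real"] by (auto elim!: eventually_mono)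
  qed
  ultimately show ?thesis
    using tendsto_upperbound by fastforce
qed

section \<open>The Littlewood-Paley inequality\<close>

text \<open>
  By Parseval the area integral is \<open>\<Sum>n. n / (n + 1) |c n|^2\<close>, because
  \<open>2 r^(2 n - 1) (1 - r^2)\<close> has integral \<open>1 / (n (n + 1))\<close> over \<open>[0, 1]\<close>; the bound on the circle means controls
  \<open>\<Sum>n. |c n|^2\<close>.
\<close>

lemma littlewood_paley:
  assumes f: "f holomorphic_on unit_disc" and K: "\<And>r. 0 < r \<Longrightarrow> r < 1 \<Longrightarrow> circle_mean (\<lambda>z. (norm (f z))\<^sup>2) r \<le> K"
  shows "(\<integral>\<^sup>+z\<in>unit_disc. ennreal ((norm (deriv f z))\<^sup>2 * (1 - (norm z)\<^sup>2)) \<partial>disc_area) \<le> ennreal K"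
proof -
  have f': "deriv f holomorphic_on unit_disc" by (rule holomorphic_deriv[OF f open_ball])
  have c: "continuous_on unit_disc (deriv f)" by (rule holomorphic_on_imp_continuous_on[OF f'])
  let ?w = "\<lambda>n r. 2 * r * (1 - r\<^sup>2) * ((norm (taylor_coeff (deriv f) n))\<^sup>2 * r ^ (2 * n))"
  have w: "(\<lambda>n. ?w n r) sums (2 * r * (1 - r\<^sup>2) * circle_mean (\<lambda>z. (norm (deriv f z))\<^sup>2) r)" if "0 < r" "r < 1" for r
    using that by (intro sums_mult parseval f') auto
  have w0: "0 \<le> ?w n r" if "0 \<le> r" "r \<le> 1" for n r
    using that by (auto intro!: mult_nonneg_nonneg simp: power_le_one)
  have "(\<integral>\<^sup>+z\<in>unit_disc. ennreal ((norm (deriv f z))\<^sup>2 * (1 - (norm z)\<^sup>2)) \<partial>disc_area) \<le> (\<integral>\<^sup>+r\<in>{0<..<1}. ennreal (\<Sum>n. ?w n r) \<partial>lborel)"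
  proof (rule nn_integral_disc_le)
    show "continuous_on unit_disc (\<lambda>z. (norm (deriv f z))\<^sup>2 * (1 - (norm z)\<^sup>2))"
      by (intro continuous_intros c)
    show "0 \<le> (norm (deriv f z))\<^sup>2 * (1 - (norm z)\<^sup>2)" if "z \<in> unit_disc" for z
      using that by (intro mult_nonneg_nonneg) (auto simp: power_le_one)
    fix r :: real assume r: "0 < r" "r < 1"
    have "circle_mean (\<lambda>z. (norm (deriv f z))\<^sup>2 * (1 - (norm z)\<^sup>2)) r = (1 - r\<^sup>2) * circle_mean (\<lambda>z. (norm (deriv f z))\<^sup>2) r"
      unfolding circle_mean_cmult[symmetric] using r by (intro circle_mean_cong) auto
    then show "2 * r * circle_mean (\<lambda>z. (norm (deriv f z))\<^sup>2 * (1 - (norm z)\<^sup>2)) r \<le> (\<Sum>n. ?w n r)"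
      using w[OF r] by (simp add: sums_iff mult.assoc)
  qed
  also have "\<dots> = (\<integral>\<^sup>+r. (\<Sum>n. ennreal (?w n r) * indicator {0<..<1} r) \<partial>lborel)"
  proof (intro nn_integral_cong)
    fix r :: real
    show "ennreal (\<Sum>n. ?w n r) * indicator {0<..<1} r = (\<Sum>n. ennreal (?w n r) * indicator {0<..<1} r)"
    proof (cases "r \<in> {0<..<1}")
      case True
      then have "(\<Sum>n. ennreal (?w n r)) = ennreal (\<Sum>n. ?w n r)"
        using w[of r] w0[of r] by (intro suminf_ennreal2) (auto simp: sums_iff)
      then show ?thesis using True by simp
    qed simp
  qed
  also have "\<dots> = (\<Sum>n. \<integral>\<^sup>+r\<in>{0<..<1}. ennreal (?w n r) \<partial>lborel)"
    by (rule nn_integral_suminf) measurable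
  also have "\<dots> \<le> (\<Sum>n. ennreal ((norm (taylor_coeff f (Suc n)))\<^sup>2))"
  proof (intro suminf_le summableI)
    fix n
    let ?A = "(norm (taylor_coeff (deriv f) n))\<^sup>2"
    let ?F = "\<lambda>r. ?A * (r ^ (2 * n + 2) / (n + 1) - r ^ (2 * n + 4) / (n + 2))"
    have "(\<integral>\<^sup>+r\<in>{0<..<1}. ennreal (?w n r) \<partial>lborel) \<le> ennreal (?F 1 - ?F 0)"
    proof (rule nn_integral_unit_interval_FTC)
      fix r :: real assume r: "0 \<le> r" "r \<le> 1"
      have e: "?w n r = ?A * (real (2 * n + 2) * r ^ (2 * n + 1) / (n + 1) - real (2 * n + 4) * r ^ (2 * n + 3) / (n + 2))"
        by (simp add: divide_simps) (simp add: algebra_simps power_add power2_eq_square power3_eq_cube)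
      have "((\<lambda>r. r ^ (2 * n + 2)) has_real_derivative real (2 * n + 2) * r ^ (2 * n + 1)) (at r)"
        "((\<lambda>r. r ^ (2 * n + 4)) has_real_derivative real (2 * n + 4) * r ^ (2 * n + 3)) (at r)"
        using DERIV_pow[of "2 * n + 2" r] DERIV_pow[of "2 * n + 4" r] by (simp_all add: numeral_3_eq_3)
      then show "(?F has_real_derivative ?w n r) (at r)"
        unfolding e by (intro DERIV_cmult DERIV_diff DERIV_cdivide)
      show "0 \<le> ?w n r" by (rule w0[OF r])
    qed measurable
    also have "?F 1 - ?F 0 = ?A * (1 / (real n + 1) - 1 / (real n + 2))"
      by (simp add: power_add add_ac)
    also have "1 / (real n + 1) - 1 / (real n + 2) = 1 / ((real n + 1) * (real n + 2))"
      by (simp add: field_simps)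
    also have "?A * (1 / ((real n + 1) * (real n + 2))) = (norm (taylor_coeff f (Suc n)))\<^sup>2 * ((n + 1) / (n + 2))"
    proof -
      have "?A = (real n + 1)\<^sup>2 * (norm (taylor_coeff f (Suc n)))\<^sup>2"
        unfolding taylor_coeff_deriv norm_mult norm_of_nat power_mult_distrib by simp
      then show ?thesis by (simp add: power2_eq_square add_ac)
    qed
    also have "ennreal \<dots> \<le> ennreal ((norm (taylor_coeff f (Suc n)))\<^sup>2)"
      by (intro ennreal_leI mult_right_le_one_le) (auto simp: divide_simps)
    finally show "(\<integral>\<^sup>+r\<in>{0<..<1}. ennreal (?w n r) \<partial>lborel) \<le> ennreal ((norm (taylor_coeff f (Suc n)))\<^sup>2)" .
  qed
  also have "\<dots> \<le> ennreal K"
  proof (unfold suminf_eq_SUP, rule SUP_least)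
    fix N
    have "(\<Sum>n<N. (norm (taylor_coeff f (Suc n)))\<^sup>2) \<le> (\<Sum>n<Suc N. (norm (taylor_coeff f n))\<^sup>2)"
      by (simp add: sum.lessThan_Suc_shift del: sum.lessThan_Suc)
    also have "\<dots> \<le> K" by (rule bessel[OF f K])
    finally show "(\<Sum>n<N. ennreal ((norm (taylor_coeff f (Suc n)))\<^sup>2)) \<le> ennreal K"
      by (simp add: ennreal_leI)
  qed
  finally show ?thesis .
qed

section \<open>Monotonicity of the Hardy means\<close>

text \<open>
  A duality argument. Pair \<open>F(z e^(i t))\<close> with the function \<open>\<phi>\<close> that is extremal for \<open>F\<close> on the circle of radius \<open>r\<close>.
  Write \<open>A s\<close> for the integral of \<open>|F|^p\<close> over the circle of radius \<open>s\<close>. The pairing \<open>H(z)\<close> is holomorphic in \<open>z\<close> and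
  \<open>H(r) = A r\<close>. On \<open>|z| = R\<close>, Young's inequality and rotation invariance bound \<open>|H|\<close> by \<open>A R / p + (1 - 1/p) A r\<close>. The maximum principle gives \<open>A r \<le> A R / p + (1 - 1/p) A r\<close>, which is the claim.
\<close>

lemma circle_mean_powr_mono:
  assumes F: "F holomorphic_on unit_disc" and p: "2 < p" and r: "0 \<le> r" "r \<le> R" "R < 1"
  shows "circle_mean (\<lambda>z. norm (F z) powr p) r \<le> circle_mean (\<lambda>z. norm (F z) powr p) R"
proof (cases "R = 0")
  case False
  with r have R0: "0 < R" "r < 1" by auto
  let ?I = "{0..2*pi}"
  let ?G = "\<lambda>t. F (of_real r * cis t)"
  \<comment> \<open>The extremal function of the duality: \<open>?G t * \<phi> t = |?G t|^p\<close> and \<open>|\<phi> t| = |?G t|^(p - 1)\<close>.\<close>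
  define \<phi> where "\<phi> t = cnj (?G t) * of_real (norm (?G t) powr (p - 2))" for t
  define H where "H z = integral (cbox 0 (2*pi)) (\<lambda>t. F (z * cis t) * \<phi> t)" for z
  define A where "A s = integral ?I (\<lambda>t. norm (F (of_real s * cis t)) powr p)" for s
  have cF: "continuous_on unit_disc F" by (rule holomorphic_on_imp_continuous_on[OF F])
  have cdF: "continuous_on unit_disc (deriv F)"
    by (intro holomorphic_on_imp_continuous_on holomorphic_deriv F) auto
  have cp: "continuous_on unit_disc (\<lambda>z. norm (F z) powr p)"
    by (rule continuous_on_powr') (use p in \<open>auto intro!: continuous_intros cF\<close>)
  have cG: "continuous_on UNIV ?G" by (intro continuous_on_circle cF r R0)
  have c\<phi>: "continuous_on UNIV \<phi>" unfolding \<phi>_def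
    by (intro continuous_intros cG continuous_on_powr') (use p in auto)
  have cz: "continuous_on S (\<lambda>t. F (z * cis t))" if "z \<in> unit_disc" for z S
    by (rule continuous_on_compose2[OF cF]) (use that in \<open>auto intro!: continuous_intros simp: norm_mult\<close>)
  have "H holomorphic_on unit_disc"
    unfolding H_def
  proof (rule leibniz_rule_holomorphic[where fx = "\<lambda>z t. deriv F (z * cis t) * cis t * \<phi> t"])
    fix z :: complex and t :: real assume z: "z \<in> unit_disc"
    have "(F has_field_derivative deriv F (z * cis t)) (at (z * cis t))"
      by (rule holomorphic_derivI[OF F open_ball]) (use z in \<open>auto simp: norm_mult\<close>)
    then have "((\<lambda>z. F (z * cis t)) has_field_derivative deriv F (z * cis t) * cis t) (at z within unit_disc)"
      by (rule DERIV_chain2) (auto intro!: derivative_eq_intros)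
    then show "((\<lambda>z. F (z * cis t) * \<phi> t) has_field_derivative deriv F (z * cis t) * cis t * \<phi> t) (at z within unit_disc)"
      by (rule DERIV_cmult_right)
    show "(\<lambda>t. F (z * cis t) * \<phi> t) integrable_on cbox 0 (2*pi)"
      by (intro integrable_continuous continuous_intros cz z continuous_on_subset[OF c\<phi>]) auto
  next
    have "continuous_on (unit_disc \<times> cbox 0 (2*pi)) (\<lambda>x. deriv F (fst x * cis (snd x)) * cis (snd x) * \<phi> (snd x))"
      by (intro continuous_intros continuous_on_compose2[OF cdF] continuous_on_compose2[OF c\<phi>])
         (auto simp: norm_mult)
    then show "continuous_on (unit_disc \<times> cbox 0 (2*pi)) (\<lambda>(z, t). deriv F (z * cis t) * cis t * \<phi> t)"
      by (simp add: case_prod_beta)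
  qed auto
  note hol = this
  have G_int: "(\<lambda>t. norm (?G t) powr p) integrable_on ?I"
    by (intro circle_integrable cp r R0)
  have sq: "x * x * x powr (p - 2) = x powr p" if "0 \<le> x" for x :: real
    using that p by (cases "x = 0") (auto simp: powr_diff power2_eq_square)
  have "H (of_real r) = of_real (A r)"
  proof -
    have "F (of_real r * cis t) * \<phi> t = of_real (norm (?G t) powr p)" for t
    proof -
      have "F (of_real r * cis t) * \<phi> t = of_real ((norm (?G t))\<^sup>2 * norm (?G t) powr (p - 2))"
        unfolding \<phi>_def mult.assoc[symmetric] complex_norm_square[symmetric] of_real_mult by simp
      then show ?thesis using sq[of "norm (?G t)"] by (simp add: power2_eq_square)
    qed
    then show ?thesis unfolding H_def A_def
      using integral_unique[OF has_integral_of_real[OF integrable_integral[OF G_int]]] by (simp add: cbox_interval)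
  qed
  moreover have "norm (H (of_real r)) \<le> A R / p + (1 - 1/p) * A r"
  proof (rule maximum_modulus_frontier[of H "cball 0 R"])
    show "H holomorphic_on interior (cball 0 R)" "continuous_on (closure (cball 0 R)) H"
      using R0 r by (auto intro!: holomorphic_on_imp_continuous_on intro: holomorphic_on_subset[OF hol])
    show "complex_of_real r \<in> cball 0 R" using r by simp
    fix z :: complex assume "z \<in> frontier (cball 0 R)"
    then have nz: "norm z = R" using R0 by (auto simp: frontier_cball)
    then have z: "z = of_real R * cis (Arg z)" by (metis rcis_def rcis_cmod_Arg)
    have zd: "z \<in> unit_disc" using nz r by simp
    have fz_int: "(\<lambda>t. norm (F (z * cis t)) powr p) integrable_on ?I"
      by (intro integrable_continuous_interval continuous_on_powr' continuous_intros cz zd) (use p in auto)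
    have A_eq: "integral ?I (\<lambda>t. norm (F (z * cis t)) powr p) = A R"
      using circle_mean_rotate[OF cp, of R "Arg z"] r R0
      unfolding circle_mean_def A_def by (subst z) (auto simp: mult_ac)
    have "norm (H z) \<le> integral (cbox 0 (2*pi)) (\<lambda>t. norm (F (z * cis t)) powr p / p + (1 - 1/p) * norm (?G t) powr p)"
      unfolding H_def
    proof (rule integral_norm_bound_integral)
      show "(\<lambda>t. F (z * cis t) * \<phi> t) integrable_on cbox 0 (2*pi)"
        by (intro integrable_continuous continuous_intros cz zd continuous_on_subset[OF c\<phi>]) auto
      show "(\<lambda>t. norm (F (z * cis t)) powr p / p + (1 - 1/p) * norm (?G t) powr p) integrable_on cbox 0 (2*pi)"
        unfolding cbox_interval by (intro integrable_add integrable_on_divide integrable_on_mult_right fz_int G_int)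
      fix t
      have q: "1 / p + 1 / (p / (p - 1)) = 1" "1 < p" "1 < p / (p - 1)" using p by (auto simp: field_simps)
      have "norm (F (z * cis t) * \<phi> t) = norm (F (z * cis t)) * (norm (?G t) powr (p - 1))"
      proof -
        have "norm (\<phi> t) = norm (?G t) * norm (?G t) powr (p - 2)"
          by (simp only: \<phi>_def norm_mult complex_mod_cnj norm_of_real) simp
        also have "\<dots> = norm (?G t) powr (p - 1)"
          using p by (cases "?G t = 0") (simp_all add: powr_diff power2_eq_square)
        finally show ?thesis by (simp add: norm_mult)
      qed
      also have "\<dots> \<le> norm (F (z * cis t)) powr p / p + (norm (?G t) powr (p - 1)) powr (p / (p - 1)) / (p / (p - 1))"
        by (rule Youngs_inequality) (use q in auto)
      also have "\<dots> = norm (F (z * cis t)) powr p / p + (1 - 1/p) * norm (?G t) powr p"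
        using p by (simp add: powr_powr divide_simps)
      finally show "norm (F (z * cis t) * \<phi> t) \<le> norm (F (z * cis t)) powr p / p + (1 - 1/p) * norm (?G t) powr p" .
    qed
    also have "\<dots> = A R / p + (1 - 1/p) * A r"
      unfolding cbox_interval
      by (subst Henstock_Kurzweil_Integration.integral_add)
         (auto intro!: integrable_on_divide integrable_on_mult_right fz_int G_int simp: A_eq A_def)
    finally show "norm (H z) \<le> A R / p + (1 - 1/p) * A r" .
  qed auto
  ultimately have "A r \<le> A R / p + (1 - 1/p) * A r"
    by (simp add: abs_le_iff)
  then have "A r \<le> A R" using p by (simp add: field_simps)
  then show ?thesis by (simp add: circle_mean_def A_def divide_right_mono)
qed (use r in auto)

lemma hardy_mean_eq: "hardy_mean p f r = circle_mean (\<lambda>z. norm (f z) powr p) r powr (1 / p)"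
  by (simp add: hardy_mean_def circle_mean_def)

text \<open>
  Since the means increase, the limit that defines the Hardy norm exists and is their supremum.
\<close>

lemma hardy_mean_le_limit:
  assumes F: "F holomorphic_on unit_disc" and p: "2 < p" and r: "0 \<le> r" "r < 1"
  shows "ennreal (hardy_mean p F r) \<le> hardy_limit p F"
proof -
  let ?m = "\<lambda>r. ennreal (hardy_mean p F r)"
  have cp: "continuous_on unit_disc (\<lambda>z. norm (F z) powr p)"
    by (rule continuous_on_powr') (use p F in \<open>auto intro!: continuous_intros holomorphic_on_imp_continuous_on\<close>)
  have mono: "?m s \<le> ?m R" if "0 \<le> s" "s \<le> R" "R < 1" for s R
    unfolding hardy_mean_eq using that p
    by (intro ennreal_leI powr_mono2 circle_mean_powr_mono F circle_mean_nonneg cp) auto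
  define L where "L = (SUP r\<in>{0..<1}. ?m r)"
  have "(?m \<longlongrightarrow> L) (at_left 1)"
  proof (rule order_tendstoI)
    fix x assume "x < L"
    then obtain s where s: "0 \<le> s" "s < 1" "x < ?m s" unfolding L_def less_SUP_iff by auto
    show "eventually (\<lambda>r. x < ?m r) (at_left 1)"
      using eventually_at_left_real[OF s(2)]
      by eventually_elim (use s mono in \<open>auto intro: less_le_trans\<close>)
  next
    fix x assume "L < x"
    have "?m r < x" if "0 \<le> r" "r < 1" for r
      unfolding L_def using that by (intro le_less_trans[OF SUP_upper \<open>L < x\<close>[unfolded L_def]]) auto
    then show "eventually (\<lambda>r. ?m r < x) (at_left 1)"
      using eventually_at_left_real[of 0 "1::real"] by (auto elim!: eventually_mono)
  qed
  then have "hardy_limit p F = L" unfolding hardy_limit_def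
    by (intro tendsto_Lim) auto
  then show ?thesis using r unfolding L_def by (auto intro!: SUP_upper)
qed

lemma circle_mean_le_hardy_norm:
  assumes F: "F \<in> hardy_space p" and p: "2 < p" and r: "0 \<le> r" "r < 1"
  shows "circle_mean (\<lambda>z. norm (F z) powr p) r \<le> hardy_norm p F powr p"
proof -
  have F': "F holomorphic_on unit_disc" "hardy_limit p F < \<infinity>" using F by (auto simp: hardy_space_def)
  have cp: "continuous_on unit_disc (\<lambda>z. norm (F z) powr p)"
    by (rule continuous_on_powr') (use p F' in \<open>auto intro!: continuous_intros holomorphic_on_imp_continuous_on\<close>)
  then have nn: "0 \<le> circle_mean (\<lambda>z. norm (F z) powr p) r" using r by (intro circle_mean_nonneg) auto
  have "enn2real (ennreal (hardy_mean p F r)) \<le> hardy_norm p F"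
    unfolding hardy_norm_def using hardy_mean_le_limit[OF F'(1) p r] F'(2)
    by (intro enn2real_mono) auto
  then have "hardy_mean p F r powr p \<le> hardy_norm p F powr p"
    using p by (intro powr_mono2) (auto simp: hardy_mean_eq)
  then show ?thesis using p nn by (simp add: hardy_mean_eq powr_powr)
qed

text \<open>
  This elementary inequality stands in for Hoelder's inequality between \<open>L^2\<close> and \<open>L^p\<close>.
  In the estimates near a point \<open>a\<close> it costs only constants, because there the \<open>p\<close>-th power means are themselves of order
  \<open>1 - |a|\<close>.
\<close>

lemma square_mult_le_powr_add:
  fixes x b p :: real
  assumes "0 \<le> x" "0 \<le> b" "b \<le> 1" "2 < p"
  shows "x\<^sup>2 * b \<le> x powr p + b"
proof (cases "x \<le> 1")
  case True
  then have "x\<^sup>2 * b \<le> 1 * b" using assms by (intro mult_right_mono) (auto simp: power_le_one)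
  then show ?thesis by (simp add: add_increasing)
next
  case False
  then have "x\<^sup>2 * b \<le> x powr 2 * 1" using assms by (intro mult_mono) (auto simp: powr_numeral)
  also have "\<dots> \<le> x powr p" using powr_mono[of 2 p x] False assms by simp
  finally show ?thesis using assms by simp
qed

lemma hardy_imp_square_summable:
  assumes F: "F \<in> hardy_space p" and p: "2 < p"
  shows "(\<Sum>n<N. (norm (taylor_coeff F n))\<^sup>2) \<le> hardy_norm p F powr p + 1"
proof (rule bessel)
  show h: "F holomorphic_on unit_disc" using F by (simp add: hardy_space_def)
  have cF: "continuous_on unit_disc F" by (rule holomorphic_on_imp_continuous_on[OF h])
  have cp: "continuous_on unit_disc (\<lambda>z. norm (F z) powr p)"
    by (rule continuous_on_powr') (use p in \<open>auto intro!: continuous_intros cF\<close>)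
  fix r :: real assume r: "0 < r" "r < 1"
  have "circle_mean (\<lambda>z. (norm (F z))\<^sup>2) r \<le> circle_mean (\<lambda>z. norm (F z) powr p + 1) r"
    using r square_mult_le_powr_add[of "norm (F z)" 1 p for z] p
    by (intro circle_mean_mono continuous_intros cF continuous_on_add cp) auto
  also have "\<dots> = circle_mean (\<lambda>z. norm (F z) powr p) r + circle_mean (\<lambda>z. 1) r"
    using r by (intro circle_mean_add cp) auto
  also have "\<dots> \<le> hardy_norm p F powr p + 1"
    using circle_mean_le_hardy_norm[OF F p, of r] r by (simp add: circle_mean_def)
  finally show "circle_mean (\<lambda>z. (norm (F z))\<^sup>2) r \<le> hardy_norm p F powr p + 1" .
qed

section \<open>Test functions concentrated near a point\<close>

text \<open>
  The functions are normalised so that they are bounded by one and comparable to one on the Carleson square of \<open>a\<close>.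
\<close>

definition test_fun :: "complex \<Rightarrow> complex \<Rightarrow> complex" where
  "test_fun a z = of_real (1 - norm a) / (1 - cnj a * z)"

lemma norm_one_minus_ge:
  assumes "norm a < 1" "norm z < 1"
  shows "1 - norm a * norm z \<le> norm (1 - cnj a * z)" "0 < 1 - norm a * norm z"
    "1 - norm a \<le> 1 - norm a * norm z" "1 - norm z \<le> 1 - norm a * norm z" "1 - cnj a * z \<noteq> 0"
proof -
  show 1: "1 - norm a * norm z \<le> norm (1 - cnj a * z)"
    using norm_triangle_ineq2[of 1 "cnj a * z"] by (simp add: norm_mult)
  show 2: "0 < 1 - norm a * norm z"
    using mult_strict_mono'[of "norm a" 1 "norm z" 1] assms by simp
  show "1 - norm a \<le> 1 - norm a * norm z" "1 - norm z \<le> 1 - norm a * norm z"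
    using assms by (auto intro: mult_left_le mult_left_le_one_le)
  show "1 - cnj a * z \<noteq> 0" using 1 2 by auto
qed

lemma test_fun_deriv:
  assumes "norm a < 1" "z \<in> unit_disc"
  shows "(test_fun a has_field_derivative of_real (1 - norm a) * cnj a / (1 - cnj a * z)\<^sup>2) (at z)"
  unfolding test_fun_def using norm_one_minus_ge(5)[of a z] assms
  by (auto intro!: derivative_eq_intros simp: power2_eq_square)

lemma test_fun_holomorphic: "norm a < 1 \<Longrightarrow> test_fun a holomorphic_on unit_disc"
  unfolding holomorphic_on_open[OF open_ball] using test_fun_deriv by blast

lemma norm_test_fun: "norm a < 1 \<Longrightarrow> norm (test_fun a z) = (1 - norm a) / norm (1 - cnj a * z)"
  by (simp add: test_fun_def norm_divide del: of_real_diff)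

lemma norm_deriv_test_fun_le:
  assumes "norm a < 1" "z \<in> unit_disc"
  shows "norm (deriv (test_fun a) z) \<le> (1 - norm a) / (norm (1 - cnj a * z))\<^sup>2"
proof -
  have "norm (deriv (test_fun a) z) = norm a * ((1 - norm a) / (norm (1 - cnj a * z))\<^sup>2)"
    using assms by (simp add: DERIV_imp_deriv[OF test_fun_deriv[OF assms]] norm_divide norm_mult norm_power del: of_real_diff)
  also have "\<dots> \<le> (1 - norm a) / (norm (1 - cnj a * z))\<^sup>2"
    using assms by (intro mult_left_le_one_le) auto
  finally show ?thesis .
qed

lemma continuous_on_kernel:
  assumes "norm a < 1"
  shows "continuous_on unit_disc (\<lambda>z. 1 / (norm (1 - cnj a * z))\<^sup>2)"
  by (intro continuous_intros) (use norm_one_minus_ge(5)[OF assms] in auto)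

text \<open>
  Parseval's identity for the geometric series \<open>1 / (1 - cnj a z)\<close>; the squares of its coefficients on the circle sum to \<open>1 / (1 - |a|^2 r^2)\<close>.
\<close>

lemma circle_mean_kernel_le:
  assumes a: "norm a < 1" and r: "0 \<le> r" "r < 1"
  shows "circle_mean (\<lambda>z. 1 / (norm (1 - cnj a * z))\<^sup>2) r \<le> 1 / (1 - norm a * r)"
proof -
  let ?g = "\<lambda>z. 1 / (1 - cnj a * z)"
  have ser: "(\<lambda>n. cnj a ^ n * z ^ n) sums ?g z" if "z \<in> unit_disc" for z
    using geometric_sums[of "cnj a * z"] norm_one_minus_ge(2)[OF a, of z] that
    by (simp add: norm_mult power_mult_distrib)
  have tc: "taylor_coeff ?g n = cnj a ^ n" for n by (rule taylor_coeff_eqI[OF ser])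
  have "?g holomorphic_on unit_disc"
    using norm_one_minus_ge(5)[OF a] by (auto intro!: holomorphic_intros)
  from parseval[OF this r] have "(\<lambda>n. (norm a * r)\<^sup>2 ^ n) sums circle_mean (\<lambda>z. (norm (?g z))\<^sup>2) r"
    by (simp add: tc norm_power power_mult power_mult_distrib mult.commute[of 2])
       (simp add: power_mult[symmetric] mult.commute)
  moreover have ar: "0 \<le> norm a * r" "norm a * r < 1"
    using norm_one_minus_ge(2)[OF a, of "of_real r"] r by (auto simp: norm_mult)
  then have "(norm a * r)\<^sup>2 \<le> norm a * r" by (simp add: power2_eq_square mult_left_le)
  then have "(\<lambda>n. (norm a * r)\<^sup>2 ^ n) sums (1 / (1 - (norm a * r)\<^sup>2))"
    using ar by (intro geometric_sums) auto
  ultimately have "circle_mean (\<lambda>z. (norm (?g z))\<^sup>2) r = 1 / (1 - (norm a * r)\<^sup>2)"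
    using sums_unique2 by blast
  also have "\<dots> \<le> 1 / (1 - norm a * r)"
    using ar \<open>(norm a * r)\<^sup>2 \<le> norm a * r\<close> by (intro divide_left_mono) (auto intro!: mult_pos_pos)
  finally show ?thesis by (simp add: norm_divide power_divide)
qed

text \<open>
  The antiderivative of \<open>(1 - \<rho> r)^(-2)\<close> is \<open>r / (1 - \<rho> r)\<close>.
\<close>

lemma radial_kernel_integral:
  assumes \<rho>: "0 \<le> \<rho>" "\<rho> < 1" and "0 \<le> M"
  shows "(\<integral>\<^sup>+r\<in>{0<..<1}. ennreal (M * (1 - \<rho>)\<^sup>2 / (1 - \<rho> * r)\<^sup>2) \<partial>lborel) \<le> ennreal (M * (1 - \<rho>))"
proof -
  let ?F = "\<lambda>r. M * (1 - \<rho>)\<^sup>2 * (r / (1 - \<rho> * r))"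
  have "(\<integral>\<^sup>+r\<in>{0<..<1}. ennreal (M * (1 - \<rho>)\<^sup>2 / (1 - \<rho> * r)\<^sup>2) \<partial>lborel) \<le> ennreal (?F 1 - ?F 0)"
  proof (rule nn_integral_unit_interval_FTC)
    fix r :: real assume r: "0 \<le> r" "r \<le> 1"
    have "1 - \<rho> * r > 0" using \<rho> r mult_left_le[of r \<rho>] by simp
    then show "(?F has_real_derivative M * (1 - \<rho>)\<^sup>2 / (1 - \<rho> * r)\<^sup>2) (at r)"
      by (auto intro!: derivative_eq_intros simp: power2_eq_square divide_simps)
         (simp add: algebra_simps)
  qed (use assms in auto)
  also have "?F 1 - ?F 0 = M * (1 - \<rho>)" using \<rho> by (simp add: power2_eq_square)
  finally show ?thesis .
qed

text \<open>
  This kernel will dominate the Dirichlet integrand of the test functions. Its circle means are at most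
  \<open>M (1 - |a|)^2 / (1 - |a| r)^2\<close>, whose radial integral is \<open>M (1 - |a|)\<close>.
\<close>

lemma nn_integral_kernel_le:
  assumes a: "norm a < 1" and M: "0 \<le> M"
  shows "(\<integral>\<^sup>+z\<in>unit_disc. ennreal (M * (1 - norm a)\<^sup>2 / ((norm (1 - cnj a * z))\<^sup>2 * (1 - norm a * norm z))) \<partial>disc_area)
    \<le> ennreal (2 * M * (1 - norm a))"
proof -
  let ?u = "\<lambda>z. M * (1 - norm a)\<^sup>2 / ((norm (1 - cnj a * z))\<^sup>2 * (1 - norm a * norm z))"
  let ?v = "\<lambda>r. M * (1 - norm a)\<^sup>2 / (1 - norm a * r)\<^sup>2"
  note n = norm_one_minus_ge[OF a]
  have n2: "1 \<noteq> norm a * norm z" if "norm z < 1" for z :: complex using n(2)[OF that] by auto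
  have "(\<integral>\<^sup>+z\<in>unit_disc. ennreal (?u z) \<partial>disc_area) \<le> (\<integral>\<^sup>+r\<in>{0<..<1}. ennreal (2 * ?v r) \<partial>lborel)"
  proof (rule nn_integral_disc_le_radial)
    show "continuous_on unit_disc ?u"
      by (intro continuous_intros) (use n(5) n2 in auto)
    show "0 \<le> ?u z" if "z \<in> unit_disc" for z using that M n(2)[of z] by auto
    fix r :: real assume r: "0 < r" "r < 1"
    have ar: "1 - norm a * r > 0" using n(2)[of "of_real r"] r by simp
    have "circle_mean ?u r = circle_mean (\<lambda>z. M * (1 - norm a)\<^sup>2 / (1 - norm a * r) * (1 / (norm (1 - cnj a * z))\<^sup>2)) r"
      using r by (intro circle_mean_cong) auto
    also have "\<dots> \<le> M * (1 - norm a)\<^sup>2 / (1 - norm a * r) * (1 / (1 - norm a * r))"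
      unfolding circle_mean_cmult using circle_mean_kernel_le[OF a, of r] r ar M by (intro mult_left_mono) auto
    finally show "circle_mean ?u r \<le> ?v r" by (simp add: power2_eq_square)
  qed
  also have "\<dots> \<le> ennreal (2 * M * (1 - norm a))"
    using radial_kernel_integral[of "norm a" "2 * M"] a M by (simp add: mult.assoc)
  finally show ?thesis .
qed

text \<open>
  With \<open>X = |1 - cnj a z|\<close> one has \<open>1 - |z| \<le> X\<close> and \<open>1 - |a| \<le> X\<close>. Of the factor \<open>((1 - |a|) / X)^p\<close> only a square is kept, and
  \<open>(1 - |z|)^(p - 1) \<le> X^(p - 1)\<close>, so the integrand is dominated by the kernel above.
\<close>

lemma dirichlet_energy_test_fun:
  assumes a: "norm a < 1" and p: "2 < p"
  shows "dirichlet_energy p (test_fun a) \<le> ennreal ((2 powr p + 1) * (1 - norm a))"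
proof -
  let ?\<delta> = "1 - norm a"
  have "(\<integral>\<^sup>+z\<in>unit_disc. ennreal (norm (deriv (test_fun a) z) powr p * (1 - (norm z)\<^sup>2) powr (p - 1)) \<partial>disc_area)
    \<le> (\<integral>\<^sup>+z\<in>unit_disc. ennreal (2 powr (p - 1) * ?\<delta>\<^sup>2 / ((norm (1 - cnj a * z))\<^sup>2 * (1 - norm a * norm z))) \<partial>disc_area)"
  proof (rule nn_integral_disc_area_mono)
    fix z :: complex assume z: "z \<in> unit_disc"
    define X where "X = norm (1 - cnj a * z)"
    define d where "d = 1 - norm a * norm z"
    have X: "d \<le> X" "0 < d" "?\<delta> \<le> d" "1 - norm z \<le> d" "0 < ?\<delta>"
      using norm_one_minus_ge[OF a, of z] z a by (auto simp: X_def d_def)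
    then have X0: "0 < X" by simp
    have "norm (deriv (test_fun a) z) powr p \<le> (?\<delta> / X\<^sup>2) powr p"
      using norm_deriv_test_fun_le[OF a z] p by (intro powr_mono2) (auto simp: X_def)
    also have "?\<delta> / X\<^sup>2 = ?\<delta> / X * X powr (- 1)"
      using X0 by (simp add: power2_eq_square powr_minus divide_simps)
    also have "(?\<delta> / X * X powr (- 1)) powr p = (?\<delta> / X) powr p * X powr (- p)"
      using X0 X by (simp add: powr_mult powr_divide powr_minus_divide)
    also have "\<dots> \<le> (?\<delta> / X) powr 2 * X powr (- p)"
      using X X0 p by (intro mult_right_mono powr_mono') auto
    finally have 1: "norm (deriv (test_fun a) z) powr p \<le> (?\<delta> / X)\<^sup>2 * X powr (- p)"
      using X X0 by (simp add: powr_numeral)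
    have "1 - (norm z)\<^sup>2 = (1 + norm z) * (1 - norm z)" by (simp add: power2_eq_square algebra_simps)
    also have "\<dots> \<le> 2 * X" using z X by (intro mult_mono) auto
    finally have "(1 - (norm z)\<^sup>2) powr (p - 1) \<le> (2 * X) powr (p - 1)"
      using z p by (intro powr_mono2) (auto simp: power_le_one)
    also have "\<dots> = 2 powr (p - 1) * X powr (p - 1)" using X0 by (simp add: powr_mult)
    finally have "norm (deriv (test_fun a) z) powr p * (1 - (norm z)\<^sup>2) powr (p - 1)
        \<le> ((?\<delta> / X)\<^sup>2 * X powr (- p)) * (2 powr (p - 1) * X powr (p - 1))"
      by (intro mult_mono 1) auto
    also have "\<dots> = 2 powr (p - 1) * (?\<delta>\<^sup>2 / (X\<^sup>2 * X))"
    proof -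
      have "((?\<delta> / X)\<^sup>2 * X powr (- p)) * (2 powr (p - 1) * X powr (p - 1)) = 2 powr (p - 1) * (?\<delta> / X)\<^sup>2 * (X powr (- p) * X powr (p - 1))"
        by (simp only: mult_ac)
      also have "X powr (- p) * X powr (p - 1) = 1 / X"
        using X0 by (simp add: powr_diff powr_minus_divide)
      finally show ?thesis by (simp add: power_divide)
    qed
    also have "\<dots> \<le> 2 powr (p - 1) * (?\<delta>\<^sup>2 / (X\<^sup>2 * d))"
      using X X0 by (intro mult_left_mono divide_left_mono) auto
    finally show "norm (deriv (test_fun a) z) powr p * (1 - (norm z)\<^sup>2) powr (p - 1)
        \<le> 2 powr (p - 1) * ?\<delta>\<^sup>2 / ((norm (1 - cnj a * z))\<^sup>2 * (1 - norm a * norm z))"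
      by (simp add: X_def d_def)
  qed
  also have "\<dots> \<le> ennreal (2 * 2 powr (p - 1) * ?\<delta>)"
    by (rule nn_integral_kernel_le[OF a]) simp
  also have "2 * 2 powr (p - 1) = (2::real) powr p" by (simp add: powr_diff)
  finally have 1: "(\<integral>\<^sup>+z\<in>unit_disc. ennreal (norm (deriv (test_fun a) z) powr p * (1 - (norm z)\<^sup>2) powr (p - 1)) \<partial>disc_area)
    \<le> ennreal (2 powr p * ?\<delta>)" .
  have "norm (test_fun a 0) = ?\<delta>" using a by (simp add: norm_test_fun)
  then have "norm (test_fun a 0) powr p \<le> ?\<delta>" using powr_mono'[of 1 p ?\<delta>] a p by simp
  then have "ennreal (norm (test_fun a 0) powr p) \<le> ennreal ?\<delta>" by (rule ennreal_leI)
  with 1 have "dirichlet_energy p (test_fun a) \<le> ennreal (2 powr p * ?\<delta>) + ennreal ?\<delta>"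
    unfolding dirichlet_energy_def by (rule add_mono)
  also have "\<dots> = ennreal ((2 powr p + 1) * ?\<delta>)" using a by (simp add: ennreal_plus[symmetric] algebra_simps del: ennreal_plus)
  finally show ?thesis .
qed

section \<open>Necessity of BMOA\<close>

lemma T_op_has_derivative:
  assumes f: "f holomorphic_on unit_disc" and g: "g holomorphic_on unit_disc" and z: "z \<in> unit_disc"
  shows "(T_op g f has_field_derivative f z * deriv g z) (at z)"
proof -
  have hol: "(\<lambda>w. f w * deriv g w) holomorphic_on unit_disc"
    by (intro holomorphic_intros f holomorphic_deriv g) auto
  obtain Q where Q: "\<And>w. w \<in> unit_disc \<Longrightarrow> (Q has_field_derivative f w * deriv g w) (at w within unit_disc)"
    using holomorphic_convex_primitive'[OF convex_ball open_ball hol] by blast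
  have T: "T_op g f w = Q w - Q 0" if "w \<in> unit_disc" for w
  proof -
    have "closed_segment 0 w \<subseteq> unit_disc"
      using that by (intro closed_segment_subset) auto
    then have "((\<lambda>w. f w * deriv g w) has_contour_integral (Q (pathfinish (linepath 0 w)) - Q (pathstart (linepath 0 w)))) (linepath 0 w)"
      by (intro contour_integral_primitive[of unit_disc]) (use Q in \<open>auto simp del: linepath_0\<close>)
    then show ?thesis by (simp add: T_op_def contour_integral_unique)
  qed
  have "((\<lambda>w. Q w - Q 0) has_field_derivative f z * deriv g z) (at z)"
    using Q[OF z] unfolding at_within_open[OF z open_ball] by (auto intro!: derivative_eq_intros)
  then show ?thesis
    by (rule has_field_derivative_transform_within_open[OF _ open_ball z]) (simp add: T)
qed

lemma T_op_holomorphic: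
  assumes "f holomorphic_on unit_disc" "g holomorphic_on unit_disc"
  shows "T_op g f holomorphic_on unit_disc"
  unfolding holomorphic_on_open[OF open_ball] using T_op_has_derivative[OF assms] by blast

text \<open>
  The Littlewood-Paley inequality is applied to \<open>G = F h\<close>, where \<open>h\<close> is the test function, so that only the part of \<open>F\<close> near \<open>a\<close>
  counts. As \<open>F' h = G' - F h'\<close>, the term \<open>F h'\<close> has to be estimated separately. In both places \<open>|F|^2 b\<close>, with a weight \<open>b \<le> 1\<close>
  made from the kernel, is bounded by \<open>|F|^p + b\<close>.
\<close>

lemma localized_area_estimate:
  assumes a: "norm a < 1" and p: "2 < p" and B: "0 \<le> B"
    and F: "F holomorphic_on unit_disc"
    and mean: "\<And>r. 0 < r \<Longrightarrow> r < 1 \<Longrightarrow> circle_mean (\<lambda>z. norm (F z) powr p) r \<le> B * (1 - norm a)"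
  shows "(\<integral>\<^sup>+z\<in>unit_disc. ennreal ((norm (deriv F z * test_fun a z))\<^sup>2 * (1 - (norm z)\<^sup>2)) \<partial>disc_area)
     \<le> ennreal (10 * (B + 1) * (1 - norm a))"
proof -
  let ?\<delta> = "1 - norm a"
  let ?h = "test_fun a"
  define G where "G z = F z * ?h z" for z
  have h: "?h holomorphic_on unit_disc" by (rule test_fun_holomorphic[OF a])
  have G: "G holomorphic_on unit_disc" unfolding G_def by (intro holomorphic_intros F h)
  note cont = holomorphic_on_imp_continuous_on
  have cF: "continuous_on unit_disc F" by (rule cont[OF F])
  have ch: "continuous_on unit_disc ?h" by (rule cont[OF h])
  have cG: "continuous_on unit_disc G" by (rule cont[OF G])
  have ch': "continuous_on unit_disc (deriv ?h)" by (intro cont holomorphic_deriv h) auto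
  have cG': "continuous_on unit_disc (deriv G)" by (intro cont holomorphic_deriv G) auto
  have cp: "continuous_on unit_disc (\<lambda>z. norm (F z) powr p)"
    by (rule continuous_on_powr') (use p in \<open>auto intro!: continuous_intros cF\<close>)
  note n = norm_one_minus_ge[OF a]
  note ck = continuous_on_kernel[OF a]
  have mean_sum: "circle_mean (\<lambda>z. norm (F z) powr p + c * (1 / (norm (1 - cnj a * z))\<^sup>2)) r \<le> B * ?\<delta> + c / (1 - norm a * r)"
    if "0 < r" "r < 1" "0 \<le> c" for r c
  proof -
    have "circle_mean (\<lambda>z. norm (F z) powr p + c * (1 / (norm (1 - cnj a * z))\<^sup>2)) r
      = circle_mean (\<lambda>z. norm (F z) powr p) r + c * circle_mean (\<lambda>z. 1 / (norm (1 - cnj a * z))\<^sup>2) r"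
      unfolding circle_mean_cmult[symmetric]
      by (intro circle_mean_add cp continuous_on_mult ck continuous_on_const) (use that in auto)
    also have "\<dots> \<le> B * ?\<delta> + c * (1 / (1 - norm a * r))"
      using that circle_mean_kernel_le[OF a, of r] by (intro add_mono mean mult_left_mono) auto
    finally show ?thesis by simp
  qed
  have G_mean: "circle_mean (\<lambda>z. (norm (G z))\<^sup>2) r \<le> (B + 1) * ?\<delta>" if r: "0 < r" "r < 1" for r
  proof -
    have nr: "?\<delta> \<le> 1 - norm a * r" "0 < 1 - norm a * r" using n(3,2)[of "of_real r"] r by auto
    have "circle_mean (\<lambda>z. (norm (G z))\<^sup>2) r \<le> circle_mean (\<lambda>z. norm (F z) powr p + ?\<delta>\<^sup>2 * (1 / (norm (1 - cnj a * z))\<^sup>2)) r"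
    proof (intro circle_mean_mono continuous_on_add cp continuous_on_mult ck continuous_on_const continuous_intros cG)
      fix z :: complex assume "norm z = r"
      with r have z: "norm z < 1" by simp
      then have "?\<delta> \<le> norm (1 - cnj a * z)" "0 < norm (1 - cnj a * z)" using n(1,3,5)[OF z] by auto
      then have "norm (?h z) \<le> 1" using a by (auto simp: norm_test_fun divide_simps)
      then have "(norm (F z))\<^sup>2 * (norm (?h z))\<^sup>2 \<le> norm (F z) powr p + (norm (?h z))\<^sup>2"
        using p by (intro square_mult_le_powr_add) (auto simp: power_le_one)
      then show "(norm (G z))\<^sup>2 \<le> norm (F z) powr p + ?\<delta>\<^sup>2 * (1 / (norm (1 - cnj a * z))\<^sup>2)"
        using a by (simp add: G_def norm_mult power_mult_distrib norm_test_fun power_divide)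
    qed (use r in auto)
    also have "\<dots> \<le> B * ?\<delta> + ?\<delta>\<^sup>2 / (1 - norm a * r)" using r by (intro mean_sum) auto
    also have "?\<delta>\<^sup>2 / (1 - norm a * r) \<le> ?\<delta>"
      using nr a by (simp add: divide_simps power2_eq_square)
    finally show ?thesis by (simp add: algebra_simps)
  qed
  have G_int: "(\<integral>\<^sup>+z\<in>unit_disc. ennreal ((norm (deriv G z))\<^sup>2 * (1 - (norm z)\<^sup>2)) \<partial>disc_area) \<le> ennreal ((B + 1) * ?\<delta>)"
    by (rule littlewood_paley[OF G G_mean])
  let ?u = "\<lambda>z. (norm (F z * deriv ?h z))\<^sup>2 * (1 - (norm z)\<^sup>2)"
  have cu: "continuous_on unit_disc ?u" by (intro continuous_intros cF ch')
  have cg: "continuous_on unit_disc (\<lambda>z. (norm (deriv G z))\<^sup>2 * (1 - (norm z)\<^sup>2))" by (intro continuous_intros cG')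
  have nz: "0 \<le> 1 - (norm z)\<^sup>2" if "z \<in> unit_disc" for z :: complex using that by (simp add: power_le_one)
  have "(\<integral>\<^sup>+z\<in>unit_disc. ennreal (?u z) \<partial>disc_area) \<le> (\<integral>\<^sup>+r\<in>{0<..<1}. ennreal (2 * (2 * (B + 1) * ?\<delta>\<^sup>2 / (1 - norm a * r)\<^sup>2)) \<partial>lborel)"
  proof (rule nn_integral_disc_le_radial[OF cu])
    show "0 \<le> ?u z" if "z \<in> unit_disc" for z using nz[OF that] by simp
    fix r :: real assume r: "0 < r" "r < 1"
    define d where "d = 1 - norm a * r"
    have d: "0 < d" "?\<delta> \<le> d" "1 - r \<le> d" using n(2-4)[of "of_real r"] r by (auto simp: d_def)
    have "circle_mean ?u r \<le> circle_mean (\<lambda>z. 2 * ?\<delta>\<^sup>2 / d^3 * (norm (F z) powr p + d\<^sup>2 * (1 / (norm (1 - cnj a * z))\<^sup>2))) r"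
    proof (intro circle_mean_mono cu continuous_on_add cp continuous_on_mult ck continuous_on_const)
      fix z :: complex assume nzr: "norm z = r"
      then have z: "norm z < 1" using r by simp
      define X where "X = norm (1 - cnj a * z)"
      have X: "d \<le> X" "0 < X" using n(1)[OF z] nzr d by (auto simp: X_def d_def)
      \<comment> \<open>The factor \<open>1 / X^4\<close> is written as \<open>b * b / d^4\<close>; one \<open>b\<close> is dropped, the other carries the decay along the circle.\<close>
      define b where "b = (d / X)\<^sup>2"
      have b: "0 \<le> b" "b \<le> 1" using X d by (auto simp: b_def power_le_one divide_simps)
      have "1 - r\<^sup>2 = (1 + r) * (1 - r)" by (simp add: power2_eq_square algebra_simps)
      also have "\<dots> \<le> 2 * d" using r d by (intro mult_mono) auto
      finally have s: "1 - r\<^sup>2 \<le> 2 * d" .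
      have "(norm (deriv ?h z))\<^sup>2 \<le> (?\<delta> / X\<^sup>2)\<^sup>2"
        using norm_deriv_test_fun_le[OF a, of z] z by (intro power_mono) (auto simp: X_def)
      then have "?u z \<le> ((norm (F z))\<^sup>2 * (?\<delta> / X\<^sup>2)\<^sup>2) * (2 * d)"
        using s r nzr unfolding norm_mult power_mult_distrib by (intro mult_mono mult_left_mono) (auto simp: power_le_one)
      also have "\<dots> = 2 * ?\<delta>\<^sup>2 / d^3 * ((norm (F z))\<^sup>2 * b * b)"
        using d X by (simp add: b_def field_simps power2_eq_square power3_eq_cube)
      also have "\<dots> \<le> 2 * ?\<delta>\<^sup>2 / d^3 * (norm (F z) powr p + b)"
      proof (rule mult_left_mono)
        have "(norm (F z))\<^sup>2 * b * b \<le> (norm (F z))\<^sup>2 * b" using b by (intro mult_left_le) auto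
        also have "\<dots> \<le> norm (F z) powr p + b" using b p by (intro square_mult_le_powr_add) auto
        finally show "(norm (F z))\<^sup>2 * b * b \<le> norm (F z) powr p + b" .
      qed (use d in auto)
      finally show "?u z \<le> 2 * ?\<delta>\<^sup>2 / d^3 * (norm (F z) powr p + d\<^sup>2 * (1 / (norm (1 - cnj a * z))\<^sup>2))"
        by (simp add: b_def X_def power_divide)
    qed (use r in auto)
    also have "\<dots> \<le> 2 * ?\<delta>\<^sup>2 / d^3 * (B * ?\<delta> + d\<^sup>2 / (1 - norm a * r))"
      unfolding circle_mean_cmult using d r by (intro mult_left_mono mean_sum) auto
    also have "\<dots> \<le> 2 * ?\<delta>\<^sup>2 / d^3 * ((B + 1) * d)"
    proof (rule mult_left_mono)
      have "B * ?\<delta> \<le> B * d" using B d by (intro mult_left_mono)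
      moreover have "d\<^sup>2 / (1 - norm a * r) = d"
        using d by (simp add: d_def[symmetric] power2_eq_square)
      ultimately show "B * ?\<delta> + d\<^sup>2 / (1 - norm a * r) \<le> (B + 1) * d"
        by (simp add: distrib_right)
    qed (use d in auto)
    also have "\<dots> = 2 * (B + 1) * ?\<delta>\<^sup>2 / d\<^sup>2" using d by (simp add: field_simps power2_eq_square power3_eq_cube)
    finally show "circle_mean ?u r \<le> 2 * (B + 1) * ?\<delta>\<^sup>2 / (1 - norm a * r)\<^sup>2" by (simp add: d_def)
  qed
  also have "\<dots> \<le> ennreal (4 * (B + 1) * ?\<delta>)"
  proof -
    have "2 * (2 * (B + 1) * ?\<delta>\<^sup>2 / x) = 4 * (B + 1) * ?\<delta>\<^sup>2 / x" for x by simp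
    then show ?thesis
      using radial_kernel_integral[of "norm a" "4 * (B + 1)"] a B by (simp only:) simp
  qed
  finally have u_int: "(\<integral>\<^sup>+z\<in>unit_disc. ennreal (?u z) \<partial>disc_area) \<le> ennreal (4 * (B + 1) * ?\<delta>)" .
  let ?g = "\<lambda>z. (norm (deriv G z))\<^sup>2 * (1 - (norm z)\<^sup>2)"
  have "(\<integral>\<^sup>+z\<in>unit_disc. ennreal ((norm (deriv F z * ?h z))\<^sup>2 * (1 - (norm z)\<^sup>2)) \<partial>disc_area)
    \<le> (\<integral>\<^sup>+z\<in>unit_disc. ennreal (2 * (?g z + ?u z)) \<partial>disc_area)"
  proof (rule nn_integral_disc_area_mono)
    fix z :: complex assume z: "z \<in> unit_disc"
    have "deriv G z = deriv F z * ?h z + F z * deriv ?h z"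
      unfolding G_def using deriv_mult[of F z ?h] F h z
      by (simp add: holomorphic_on_imp_differentiable_at[OF _ open_ball] add.commute)
    then have "norm (deriv F z * ?h z) \<le> norm (deriv G z) + norm (F z * deriv ?h z)"
      using norm_triangle_ineq4[of "deriv G z" "F z * deriv ?h z"] by simp
    then have "(norm (deriv F z * ?h z))\<^sup>2 \<le> (norm (deriv G z) + norm (F z * deriv ?h z))\<^sup>2"
      by (rule power_mono) simp
    also have "\<dots> \<le> 2 * ((norm (deriv G z))\<^sup>2 + (norm (F z * deriv ?h z))\<^sup>2)"
      using sum_squares_bound[of "norm (deriv G z)" "norm (F z * deriv ?h z)"] by (simp add: power2_sum)
    finally have "(norm (deriv F z * ?h z))\<^sup>2 * (1 - (norm z)\<^sup>2) \<le> (2 * ((norm (deriv G z))\<^sup>2 + (norm (F z * deriv ?h z))\<^sup>2)) * (1 - (norm z)\<^sup>2)"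
      by (rule mult_right_mono) (rule nz[OF z])
    then show "(norm (deriv F z * ?h z))\<^sup>2 * (1 - (norm z)\<^sup>2) \<le> 2 * (?g z + ?u z)"
      by (simp add: algebra_simps)
  qed
  also have "\<dots> = (\<integral>\<^sup>+z. 2 * (ennreal (?g z) * indicator unit_disc z + ennreal (?u z) * indicator unit_disc z) \<partial>disc_area)"
  proof (intro nn_integral_cong)
    fix z :: complex
    show "ennreal (2 * (?g z + ?u z)) * indicator unit_disc z = 2 * (ennreal (?g z) * indicator unit_disc z + ennreal (?u z) * indicator unit_disc z)"
      using nz[of z] by (cases "z \<in> unit_disc") (auto simp: ennreal_mult ennreal_plus)
  qed
  also have "\<dots> = 2 * ((\<integral>\<^sup>+z\<in>unit_disc. ennreal (?g z) \<partial>disc_area) + (\<integral>\<^sup>+z\<in>unit_disc. ennreal (?u z) \<partial>disc_area))"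
    using disc_measurable[OF cu] disc_measurable[OF cg]
    by (subst nn_integral_cmult, measurable, subst nn_integral_add) auto
  also have "\<dots> \<le> 2 * (ennreal ((B + 1) * ?\<delta>) + ennreal (4 * (B + 1) * ?\<delta>))"
    by (intro mult_left_mono add_mono G_int u_int) auto
  also have "\<dots> = ennreal (10 * (B + 1) * ?\<delta>)"
  proof -
    define c where "c = (B + 1) * ?\<delta>"
    have c: "0 \<le> c" unfolding c_def using a B by (intro mult_nonneg_nonneg) auto
    have "ennreal c + ennreal (4 * c) = ennreal (5 * c)"
      using c by (subst ennreal_plus[symmetric]) auto
    then have "2 * (ennreal c + ennreal (4 * c)) = ennreal 2 * ennreal (5 * c)" by (simp only: ennreal_numeral)
    also have "\<dots> = ennreal (10 * c)" using c by (subst ennreal_mult[symmetric]) auto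
    finally show ?thesis by (simp only: c_def mult.assoc)
  qed
  finally show ?thesis .
qed

text \<open>
  The argument determines the angle only modulo \<open>2 pi\<close>, hence the integer \<open>k\<close>.
\<close>

lemma centred_arc_angle:
  assumes a: "a \<noteq> 0" and t: "cis t \<in> centred_arc a"
  obtains s :: real and k :: int where "\<bar>s\<bar> \<le> pi * (1 - norm a)" "t = Arg a + s + 2 * pi * of_int k"
proof -
  obtain \<theta> where \<theta>: "cis t = cis \<theta>" "\<bar>Arg (a * cis (- \<theta>))\<bar> \<le> pi * (1 - norm a)"
    using t by (auto simp: centred_arc_def)
  define s where "s = Arg (a * cis (- \<theta>))"
  have "cis (- \<theta>) = cis (- t)" using \<theta>(1) by (metis cis_cnj)
  then have "a * cis (- t) = of_real (norm a) * cis s"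
    using rcis_cmod_Arg[of "a * cis (- \<theta>)"] by (simp add: s_def rcis_def norm_mult)
  moreover have "a = of_real (norm a) * cis (Arg a)" using rcis_cmod_Arg[of a] by (simp add: rcis_def)
  ultimately have "of_real (norm a) * (cis (Arg a) * cis (- t)) = of_real (norm a) * cis s"
    by (metis mult.assoc)
  then have "cis (Arg a - t) = cis s" using a by (simp add: cis_mult)
  then have "cis (Arg a - t - s) = 1" by (metis cis_divide cis_neq_zero divide_self)
  then have "cos (Arg a - t - s) = 1" by (metis cis.sel(1) one_complex.sel(1))
  then obtain k :: int where "Arg a - t - s = of_int k * 2 * pi" using cos_one_2pi_int by auto
  then show ?thesis using \<theta>(2) by (intro that[of "- s" "- k"]) (auto simp: s_def algebra_simps)
qed

lemma arc_length_le_one: "arc_length I \<le> 1"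
proof (cases "{t \<in> {0..<2 * pi}. cis t \<in> I} \<in> sets lborel")
  case True
  have "measure lborel {t \<in> {0..<2 * pi}. cis t \<in> I} \<le> measure lborel {0..2*pi}"
    by (rule measure_mono_fmeasurable) (use True in \<open>auto simp: fmeasurable_def\<close>)
  then show ?thesis by (simp add: arc_length_def)
next
  case False
  then show ?thesis by (simp add: arc_length_def measure_notin_sets)
qed

text \<open>
  The arc has length exactly \<open>1 - |a|\<close>. The crude factor 3 counts the translates by \<open>- 2 pi\<close>, \<open>0\<close> and \<open>2 pi\<close> of one interval
  of angles and avoids a discussion of how the arc meets the cut of the argument; a bounded factor is harmless.
\<close>

lemma arc_length_centred_arc_le:
  assumes a: "a \<noteq> 0" "norm a < 1"
  shows "arc_length (centred_arc a) \<le> 3 * (1 - norm a)"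
proof (cases "{t \<in> {0..<2 * pi}. cis t \<in> centred_arc a} \<in> sets lborel")
  case True
  let ?A = "{t \<in> {0..<2 * pi}. cis t \<in> centred_arc a}"
  let ?\<eta> = "pi * (1 - norm a)"
  let ?J = "\<lambda>k::int. {Arg a + 2 * pi * of_int k - ?\<eta>..Arg a + 2 * pi * of_int k + ?\<eta>}"
  have \<eta>: "0 \<le> ?\<eta>" "?\<eta> \<le> pi" using a by (auto intro: mult_left_le)
  have "?A \<subseteq> (\<Union>k\<in>{-1..1}. ?J k)"
  proof
    fix t assume "t \<in> ?A"
    then have t: "0 \<le> t" "t < 2 * pi" and c: "cis t \<in> centred_arc a" by auto
    obtain s and k :: int where sk: "\<bar>s\<bar> \<le> ?\<eta>" "t = Arg a + s + 2 * pi * of_int k"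
      using centred_arc_angle[OF a(1) c] .
    have "- pi < Arg a" "Arg a \<le> pi" using mpi_less_Arg Arg_le_pi by auto
    then have "2 * pi * of_int k < 2 * pi * 2" "2 * pi * (- 2) < 2 * pi * of_int k"
      using sk t \<eta> by linarith+
    then have "real_of_int k < 2" "- 2 < real_of_int k"
      using mult_less_cancel_left_pos[of "2 * pi" "of_int k" 2] mult_less_cancel_left_pos[of "2 * pi" "- 2" "of_int k"]
      by simp_all
    then have "k \<in> {-1..1}" by auto
    moreover have "t \<in> ?J k" using sk by auto
    ultimately show "t \<in> (\<Union>k\<in>{-1..1}. ?J k)" by blast
  qed
  then have "measure lborel ?A \<le> measure lborel (\<Union>k\<in>{-1..1::int}. ?J k)"
    using True by (intro measure_mono_fmeasurable fmeasurable.finite_UN) (auto simp: fmeasurable_def emeasure_lborel_Icc_eq)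
  also have "\<dots> \<le> (\<Sum>k\<in>{-1..1::int}. measure lborel (?J k))"
    by (intro measure_UNION_le) auto
  also have "\<dots> = 3 * (2 * ?\<eta>)" using \<eta> by simp
  finally show ?thesis by (simp add: arc_length_def field_simps)
next
  case False
  then show ?thesis using a by (simp add: arc_length_def measure_notin_sets)
qed

text \<open>
  Write \<open>cnj a * z = |a| r e^(i s)\<close>, with \<open>s\<close> the angle between \<open>z\<close> and \<open>a\<close>. Then \<open>|1 - cnj a * z| \<le> |s| + (1 - |a| r)\<close>, and both terms are at most a
  multiple of \<open>1 - |a|\<close>.
\<close>

lemma carleson_square_kernel_bound:
  assumes a: "a \<noteq> 0" "norm a < 1" and z: "z \<in> carleson_square (centred_arc a)"
  shows "z \<in> unit_disc" "norm (1 - cnj a * z) \<le> 8 * (1 - norm a)"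
proof -
  obtain r t where z: "z = of_real r * cis t" "cis t \<in> centred_arc a" "1 - arc_length (centred_arc a) \<le> r" "r < 1"
    using z by (auto simp: carleson_square_def)
  have r: "0 \<le> r" "1 - r \<le> 3 * (1 - norm a)"
    using z arc_length_le_one[of "centred_arc a"] arc_length_centred_arc_le[OF a] by auto
  then show "z \<in> unit_disc" using z by (simp add: norm_mult)
  obtain s and k :: int where sk: "\<bar>s\<bar> \<le> pi * (1 - norm a)" "t = Arg a + s + 2 * pi * of_int k"
    using centred_arc_angle[OF a(1) z(2)] .
  have "cis t = cis (Arg a) * cis s * cis (2 * pi * of_int k)" unfolding sk by (simp only: cis_mult)
  then have ct: "cis t = cis (Arg a) * cis s" by (simp add: cis_multiple_2pi)
  have a_polar: "a = of_real (norm a) * cis (Arg a)" using rcis_cmod_Arg[of a] by (simp add: rcis_def)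
  have "cnj a = of_real (norm a) * cis (- Arg a)"
    by (subst a_polar) (simp add: cis_cnj)
  then have "cnj a * z = of_real (norm a * r) * (cis (- Arg a) * (cis (Arg a) * cis s))"
    unfolding z ct of_real_mult by (simp only: mult_ac)
  also have "cis (- Arg a) * (cis (Arg a) * cis s) = cis s" by (simp only: cis_mult) simp
  finally have az: "cnj a * z = of_real (norm a * r) * cis s" .
  have "norm (1 - cis s) \<le> \<bar>s\<bar>"
  proof -
    have "norm (exp (\<i> * of_real s) - 1) = 2 * \<bar>sin (s / 2)\<bar>" by (rule dist_exp_i_1)
    also have "\<dots> \<le> \<bar>s\<bar>" using abs_sin_x_le_abs_x[of "s/2"] by simp
    finally show ?thesis by (simp add: cis_conv_exp norm_minus_commute)
  qed
  moreover have "norm (cis s - of_real (norm a * r) * cis s) = 1 - norm a * r"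
  proof -
    have "cis s - of_real (norm a * r) * cis s = of_real (1 - norm a * r) * cis s" by (simp add: algebra_simps)
    moreover have "norm a * r \<le> 1" using a r z by (intro mult_le_one) auto
    ultimately show ?thesis by (simp add: norm_mult del: of_real_diff)
  qed
  moreover have "1 - norm a * r \<le> (1 - norm a) + (1 - r)"
  proof -
    have "0 \<le> (1 - norm a) * (1 - r)" using a z by simp
    then show ?thesis by (simp add: algebra_simps)
  qed
  moreover have "norm (1 - cnj a * z) \<le> norm (1 - cis s) + norm (cis s - of_real (norm a * r) * cis s)"
    unfolding az using norm_triangle_ineq[of "1 - cis s" "cis s - of_real (norm a * r) * cis s"] by simp
  ultimately have "norm (1 - cnj a * z) \<le> \<bar>s\<bar> + ((1 - norm a) + (1 - r))" by simp
  also have "\<bar>s\<bar> \<le> 4 * (1 - norm a)"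
    using sk(1) mult_right_mono[of pi 4 "1 - norm a"] a pi_less_4 by simp
  finally show "norm (1 - cnj a * z) \<le> 8 * (1 - norm a)" using r by simp
qed

text \<open>
  Boundedness is tested on \<open>h = test_fun a\<close>. Its \<open>p\<close>-th power norm is of order \<open>1 - |a|\<close>, hence so are the
  \<open>p\<close>-th power means of \<open>F = T_op g h\<close>, and the localized estimate applies. On the Carleson square \<open>|h| \<ge> 1/8\<close>, and there
  \<open>F' h = g' h^2\<close> dominates \<open>g'\<close>.
\<close>

lemma T_op_bounded_imp_BMOA:
  assumes p: "2 < p" and g: "g holomorphic_on unit_disc"
    and T: "bounded_operator (dirichlet_space p) (dirichlet_norm p) (hardy_space p) (hardy_norm p) (T_op g)"
  shows "g \<in> BMOA"
proof -
  obtain C where TX: "\<And>f. f \<in> dirichlet_space p \<Longrightarrow> T_op g f \<in> hardy_space p"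
    and C: "\<And>f. f \<in> dirichlet_space p \<Longrightarrow> hardy_norm p (T_op g f) \<le> C * dirichlet_norm p f"
    using T unfolding bounded_operator_def by blast
  define B where "B = \<bar>C\<bar> powr p * (2 powr p + 1)"
  have B: "0 \<le> B" by (simp add: B_def)
  define M where "M = 4096 * (10 * (B + 1))"
  have local: "(\<integral>\<^sup>+z\<in>carleson_square (centred_arc a). ennreal ((norm (deriv g z))\<^sup>2 * (1 - (norm z)\<^sup>2)) \<partial>disc_area)
     \<le> ennreal (M * (1 - norm a))" if a: "a \<noteq> 0" "norm a < 1" for a
  proof -
    let ?h = "test_fun a" and ?\<delta> = "1 - norm a"
    define F where "F = T_op g ?h"
    have h: "?h holomorphic_on unit_disc" by (rule test_fun_holomorphic[OF a(2)])
    have E: "dirichlet_energy p ?h \<le> ennreal ((2 powr p + 1) * ?\<delta>)" by (rule dirichlet_energy_test_fun[OF a(2) p])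
    have hD: "?h \<in> dirichlet_space p"
      unfolding dirichlet_space_def using h E by (auto intro: le_less_trans)
    have F: "F holomorphic_on unit_disc" unfolding F_def by (rule T_op_holomorphic[OF h g])
    have dF: "deriv F z = ?h z * deriv g z" if "z \<in> unit_disc" for z
      unfolding F_def using T_op_has_derivative[OF h g that] by (rule DERIV_imp_deriv)
    have D: "dirichlet_norm p ?h powr p \<le> (2 powr p + 1) * ?\<delta>"
    proof -
      have "enn2real (dirichlet_energy p ?h) \<le> (2 powr p + 1) * ?\<delta>"
        using enn2real_mono[OF E] a by (simp add: mult_nonneg_nonneg)
      then show ?thesis using p by (simp add: dirichlet_norm_def powr_powr)
    qed
    have mean: "circle_mean (\<lambda>z. norm (F z) powr p) r \<le> B * ?\<delta>" if "0 < r" "r < 1" for r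
    proof -
      have "circle_mean (\<lambda>z. norm (F z) powr p) r \<le> hardy_norm p F powr p"
        unfolding F_def using that by (intro circle_mean_le_hardy_norm TX hD p) auto
      also have "\<dots> \<le> (\<bar>C\<bar> * dirichlet_norm p ?h) powr p"
      proof (rule powr_mono2)
        have "C * dirichlet_norm p ?h \<le> \<bar>C\<bar> * dirichlet_norm p ?h"
          by (intro mult_right_mono) (auto simp: dirichlet_norm_def)
        then show "hardy_norm p F \<le> \<bar>C\<bar> * dirichlet_norm p ?h" using C[OF hD] by (simp add: F_def)
      qed (use p in \<open>auto simp: hardy_norm_def\<close>)
      also have "\<dots> = \<bar>C\<bar> powr p * dirichlet_norm p ?h powr p"
        by (rule powr_mult)
      also have "\<dots> \<le> \<bar>C\<bar> powr p * ((2 powr p + 1) * ?\<delta>)" by (intro mult_left_mono D) auto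
      finally show ?thesis by (simp add: B_def mult.assoc)
    qed
    let ?G = "\<lambda>z. (norm (deriv F z * ?h z))\<^sup>2 * (1 - (norm z)\<^sup>2)"
    have "(\<integral>\<^sup>+z\<in>carleson_square (centred_arc a). ennreal ((norm (deriv g z))\<^sup>2 * (1 - (norm z)\<^sup>2)) \<partial>disc_area)
      \<le> (\<integral>\<^sup>+z. 4096 * (ennreal (?G z) * indicator unit_disc z) \<partial>disc_area)"
    proof (intro nn_integral_mono)
      fix z
      show "ennreal ((norm (deriv g z))\<^sup>2 * (1 - (norm z)\<^sup>2)) * indicator (carleson_square (centred_arc a)) z
        \<le> 4096 * (ennreal (?G z) * indicator unit_disc z)"
      proof (cases "z \<in> carleson_square (centred_arc a)")
        case True
        note z = carleson_square_kernel_bound[OF a True]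
        have "0 < norm (1 - cnj a * z)" using norm_one_minus_ge(5)[OF a(2), of z] z by auto
        then have "1 / 8 \<le> norm (?h z)" using z(2) a by (simp add: norm_test_fun divide_simps)
        \<comment> \<open>The constant 4096 is \<open>8^4\<close>.\<close>
        then have "(1 / 8) ^ 4 \<le> norm (?h z) ^ 4" by (intro power_mono) auto
        then have "1 * (norm (deriv g z))\<^sup>2 \<le> (4096 * norm (?h z) ^ 4) * (norm (deriv g z))\<^sup>2"
          by (intro mult_right_mono) (auto simp: power_divide)
        then have "(norm (deriv g z))\<^sup>2 \<le> 4096 * (norm (deriv F z * ?h z))\<^sup>2"
          using z(1) by (simp add: dF norm_mult power_mult_distrib power4_eq_xxxx power2_eq_square mult_ac)
        then have "(norm (deriv g z))\<^sup>2 * (1 - (norm z)\<^sup>2) \<le> (4096 * (norm (deriv F z * ?h z))\<^sup>2) * (1 - (norm z)\<^sup>2)"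
          using z(1) by (intro mult_right_mono) (auto simp: power_le_one)
        then have "ennreal ((norm (deriv g z))\<^sup>2 * (1 - (norm z)\<^sup>2)) \<le> ennreal (4096 * ?G z)"
          by (intro ennreal_leI) (simp add: mult.assoc)
        also have "\<dots> = 4096 * ennreal (?G z)" by (subst ennreal_mult') auto
        finally show ?thesis using True z(1) by simp
      qed simp
    qed
    also have "\<dots> = 4096 * (\<integral>\<^sup>+z\<in>unit_disc. ennreal (?G z) \<partial>disc_area)"
    proof (rule nn_integral_cmult)
      have "continuous_on unit_disc ?G"
        by (intro continuous_intros holomorphic_on_imp_continuous_on holomorphic_deriv F h) auto
      from disc_measurable[OF this] show "(\<lambda>z. ennreal (?G z) * indicator unit_disc z) \<in> borel_measurable disc_area" by simp
    qed
    also have "\<dots> \<le> 4096 * ennreal (10 * (B + 1) * ?\<delta>)"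
      by (intro mult_left_mono localized_area_estimate[OF a(2) p B F mean]) auto
    also have "\<dots> = ennreal (M * ?\<delta>)"
    proof -
      have "ennreal (4096 * (10 * (B + 1) * ?\<delta>)) = 4096 * ennreal (10 * (B + 1) * ?\<delta>)"
        by (subst ennreal_mult') auto
      moreover have "M * ?\<delta> = 4096 * (10 * (B + 1) * ?\<delta>)" by (simp only: M_def mult.assoc)
      ultimately show ?thesis by (simp only:)
    qed
    finally show ?thesis .
  qed
  have M: "0 \<le> M" using B by (simp add: M_def)
  have "(SUP a\<in>unit_disc - {0}. (\<integral>\<^sup>+z\<in>carleson_square (centred_arc a). ennreal ((norm (deriv g z))\<^sup>2 * (1 - (norm z)\<^sup>2)) \<partial>disc_area) / ennreal (1 - norm a))
     \<le> ennreal M"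
  proof (rule SUP_least)
    fix a :: complex assume "a \<in> unit_disc - {0}"
    then have a: "a \<noteq> 0" "norm a < 1" by auto
    have "(\<integral>\<^sup>+z\<in>carleson_square (centred_arc a). ennreal ((norm (deriv g z))\<^sup>2 * (1 - (norm z)\<^sup>2)) \<partial>disc_area) / ennreal (1 - norm a)
       \<le> ennreal (M * (1 - norm a)) / ennreal (1 - norm a)"
      by (rule divide_right_mono_ennreal[OF local[OF a]])
    also have "\<dots> = ennreal M" using a M by (subst divide_ennreal) auto
    finally show "(\<integral>\<^sup>+z\<in>carleson_square (centred_arc a). ennreal ((norm (deriv g z))\<^sup>2 * (1 - (norm z)\<^sup>2)) \<partial>disc_area) / ennreal (1 - norm a) \<le> ennreal M" .
  qed
  then have "bmoa_energy g \<le> ennreal M + ennreal ((norm (g 0))\<^sup>2)"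
    unfolding bmoa_energy_def by (rule add_right_mono)
  also have "\<dots> < \<infinity>" by simp
  finally show ?thesis using g by (simp add: BMOA_def)
qed

section \<open>Gap series\<close>

definition gap_series :: "(nat \<Rightarrow> nat) \<Rightarrow> (nat \<Rightarrow> real) \<Rightarrow> complex \<Rightarrow> complex" where
  "gap_series N a z = (\<Sum>k. of_real (a k) * z ^ N k)"

text \<open>
  Indexing by all exponents, with zeros in the gaps, makes the results on Taylor coefficients applicable.
\<close>

definition gap_coeff :: "(nat \<Rightarrow> nat) \<Rightarrow> (nat \<Rightarrow> real) \<Rightarrow> nat \<Rightarrow> real" where
  "gap_coeff N a n = (if n \<in> range N then a (inv N n) else 0)"

lemma gap_coeff_at: "strict_mono N \<Longrightarrow> gap_coeff N a (N k) = a k"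
  by (simp add: gap_coeff_def strict_mono_imp_inj_on)

lemma gap_coeff_nonneg: "(\<And>k. 0 \<le> a k) \<Longrightarrow> 0 \<le> gap_coeff N a n"
  by (simp add: gap_coeff_def)

lemma gap_series_sums:
  assumes N: "strict_mono N" and a: "\<And>k. \<bar>a k\<bar> \<le> 1" and z: "z \<in> unit_disc"
  shows "(\<lambda>n. of_real (gap_coeff N a n) * z ^ n) sums gap_series N a z"
proof -
  have "summable (\<lambda>k. of_real (a k) * z ^ N k)"
  proof (rule summable_comparison_test')
    show "summable (\<lambda>k. norm z ^ k)" using z by (intro summable_geometric) auto
    fix k :: nat
    have "k \<le> N k" by (rule strict_mono_imp_increasing[OF N])
    then have le: "norm z ^ N k \<le> norm z ^ k" using z by (intro power_decreasing) auto
    show "norm (of_real (a k) * z ^ N k) \<le> norm z ^ k"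
      using mult_mono[OF a[of k] le] by (simp add: norm_mult norm_power)
  qed
  then have "(\<lambda>k. of_real (gap_coeff N a (N k)) * z ^ N k) sums gap_series N a z"
    unfolding gap_series_def gap_coeff_at[OF N] by (rule summable_sums)
  then show ?thesis
    by (subst (asm) sums_mono_reindex[OF N, where f = "\<lambda>n. of_real (gap_coeff N a n) * z ^ n"])
       (auto simp: gap_coeff_def)
qed

lemma gap_series_holomorphic:
  assumes "strict_mono N" "\<And>k. \<bar>a k\<bar> \<le> 1"
  shows "gap_series N a holomorphic_on unit_disc"
  by (rule power_series_holomorphic[where a = "\<lambda>n. of_real (gap_coeff N a n)"])
     (use gap_series_sums[OF assms] in auto)

lemma taylor_coeff_gap_series:
  assumes "strict_mono N" "\<And>k. \<bar>a k\<bar> \<le> 1"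
  shows "taylor_coeff (gap_series N a) n = of_real (gap_coeff N a n)"
  by (rule taylor_coeff_eqI[OF gap_series_sums[OF assms]])

lemma gap_series_disc_algebra:
  assumes N: "strict_mono N" and a: "\<And>k. \<bar>a k\<bar> \<le> 1" and s: "summable (\<lambda>k. \<bar>a k\<bar>)"
  shows "gap_series N a \<in> disc_algebra"
proof -
  have "uniform_limit (cball 0 1) (\<lambda>n z. \<Sum>k<n. of_real (a k) * z ^ N k) (gap_series N a) sequentially"
    unfolding gap_series_def
  proof (rule Weierstrass_m_test)
    fix k and z :: complex assume "z \<in> cball 0 1"
    then show "norm (of_real (a k) * z ^ N k) \<le> \<bar>a k\<bar>"
      by (simp add: norm_mult norm_power mult_left_le power_le_one)
  qed (rule s)
  then have "continuous_on (cball 0 1) (gap_series N a)"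
    by (rule uniform_limit_theorem[rotated]) (auto intro!: continuous_intros always_eventually)
  then show ?thesis
    unfolding disc_algebra_def using gap_series_holomorphic[OF N a] by (auto intro!: exI[of _ "gap_series N a"])
qed

text \<open>
  Jensen's inequality for \<open>t \<mapsto> t^p\<close> and the probability weights \<open>x k / X\<close>, where \<open>X\<close> is the sum of the \<open>x k\<close>.
\<close>

lemma power_mean_weighted:
  fixes a x :: "nat \<Rightarrow> real"
  assumes p: "1 \<le> p" and a: "\<And>k. 0 < a k" and x: "\<And>k. 0 \<le> x k" and pos: "0 < (\<Sum>k<K. x k)"
  shows "(\<Sum>k<K. a k * x k) powr p \<le> (\<Sum>k<K. x k) powr (p - 1) * (\<Sum>k<K. a k powr p * x k)"
proof -
  define X where "X = (\<Sum>k<K. x k)"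
  have X: "0 < X" using pos by (simp add: X_def)
  have "(\<Sum>k<K. (x k / X) *\<^sub>R a k) powr p \<le> (\<Sum>k<K. (x k / X) * a k powr p)"
  proof (rule convex_on_sum[OF _ _ powr_convex[OF p]])
    show "(\<Sum>k<K. x k / X) = 1" using X by (simp add: sum_divide_distrib[symmetric] X_def)
    show "{..<K} \<noteq> {}" using pos by (cases "K = 0") auto
  qed (use X a x in auto)
  moreover have "(\<Sum>k<K. a k * x k) = X * (\<Sum>k<K. (x k / X) *\<^sub>R a k)"
    using X by (simp add: sum_distrib_left mult_ac)
  moreover have "0 \<le> (\<Sum>k<K. (x k / X) *\<^sub>R a k)"
    by (intro sum_nonneg scaleR_nonneg_nonneg divide_nonneg_pos x X less_imp_le[OF a])
  ultimately have "(\<Sum>k<K. a k * x k) powr p \<le> X powr p * (\<Sum>k<K. (x k / X) * a k powr p)"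
    using X by (simp add: powr_mult mult_left_mono)
  also have "\<dots> = X powr p / X * (\<Sum>k<K. a k powr p * x k)"
    using X by (simp add: sum_distrib_left mult_ac)
  also have "X powr p / X = X powr (p - 1)" using X by (simp add: powr_diff)
  finally show ?thesis by (simp add: X_def)
qed

text \<open>
  Each term with \<open>k \<ge> 1\<close> is at most twice the sum of the powers \<open>r^j\<close> over the block \<open>2^(k - 1) \<le> j < 2^k\<close>, and the blocks make up a geometric series.
\<close>

lemma dyadic_sum_le:
  fixes r :: real
  assumes r: "0 \<le> r" "r < 1"
  shows "(\<Sum>k<K. 2 ^ k * r ^ (2 ^ k - 1)) \<le> 2 / (1 - r)"
proof -
  have step: "(\<Sum>k<Suc K. 2 ^ k * r ^ (2 ^ k - 1)) \<le> 2 * (\<Sum>j<2 ^ K. r ^ j)" for K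
  proof (induction K)
    case (Suc K)
    have "2 ^ Suc K * r ^ (2 ^ Suc K - 1) = 2 * (\<Sum>j\<in>{(2::nat) ^ K..<2 ^ Suc K}. r ^ (2 ^ Suc K - 1))"
    proof -
      have "card {(2::nat) ^ K..<2 ^ Suc K} = 2 ^ K" by simp
      then show ?thesis by (simp add: sum_constant)
    qed
    also have "\<dots> \<le> 2 * (\<Sum>j\<in>{(2::nat) ^ K..<2 ^ Suc K}. r ^ j)"
      using r by (intro mult_left_mono sum_mono power_decreasing) auto
    finally have "(\<Sum>k<Suc (Suc K). 2 ^ k * r ^ (2 ^ k - 1)) \<le> 2 * (\<Sum>j<2 ^ K. r ^ j) + 2 * (\<Sum>j\<in>{(2::nat) ^ K..<2 ^ Suc K}. r ^ j)"
      using Suc.IH by (simp only: sum.lessThan_Suc[of _ "Suc K"])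
    moreover have "(\<Sum>j<2 ^ K. r ^ j) + (\<Sum>j\<in>{(2::nat) ^ K..<2 ^ Suc K}. r ^ j) = (\<Sum>j<2 ^ Suc K. r ^ j)"
      unfolding lessThan_atLeast0 by (rule sum.atLeastLessThan_concat) auto
    ultimately show ?case by linarith
  qed simp
  have geo: "(\<Sum>j<n. r ^ j) \<le> 1 / (1 - r)" for n
    using r by (subst sum_gp_strict) (auto simp: divide_simps)
  have "(\<Sum>k<K. 2 ^ k * r ^ (2 ^ k - 1)) \<le> (\<Sum>k<Suc K. 2 ^ k * r ^ (2 ^ k - 1))" using r by simp
  also have "\<dots> \<le> 2 * (\<Sum>j<2 ^ K. r ^ j)" by (rule step)
  also have "\<dots> \<le> 2 / (1 - r)" using geo[of "2 ^ K"] by simp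
  finally show ?thesis .
qed

lemma strict_mono_power2: "strict_mono (\<lambda>k::nat. (2::nat) ^ k)"
  by (simp add: strict_mono_def)

text \<open>
  Put \<open>x k = 2^k r^(2^k - 1)\<close>, so that \<open>|f'| \<le> \<Sum>k. a k x k\<close> on the circle of radius \<open>r\<close> and \<open>\<Sum>k. x k \<le> 2 / (1 - r)\<close>. Jensen's
  inequality gives \<open>|f'|^p \<le> (2 / (1 - r))^(p - 1) \<Sum>k. a k^p x k\<close>; the weight of the Dirichlet-type space cancels the
  first factor, and each \<open>x k\<close> has integral one over \<open>[0, 1]\<close>.
\<close>

lemma lacunary_in_dirichlet_space:
  assumes p: "1 < p" and a: "\<And>k. 0 < a k" "\<And>k. a k \<le> 1" and s: "summable (\<lambda>k. a k powr p)"
  shows "gap_series (\<lambda>k. 2 ^ k) a \<in> dirichlet_space p"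
proof -
  define f where "f = gap_series (\<lambda>k. 2 ^ k) a"
  define x where "x r k = 2 ^ k * r ^ (2 ^ k - 1)" for r :: real and k :: nat
  have a': "\<bar>a k\<bar> \<le> 1" for k using a[of k] by simp
  have f: "f holomorphic_on unit_disc"
    unfolding f_def by (rule gap_series_holomorphic[OF strict_mono_power2 a'])
  have f': "deriv f holomorphic_on unit_disc" by (intro holomorphic_deriv f) auto
  have deriv_sums: "(\<lambda>k. of_real (a k) * (2 ^ k * z ^ (2 ^ k - 1))) sums deriv f z" if z: "z \<in> unit_disc" for z
  proof -
    \<comment> \<open>The derivative is again a gap series, with exponents \<open>2^k - 1\<close>.\<close>
    let ?N = "\<lambda>k. 2 ^ k - 1 :: nat"
    have "strict_mono ?N" by (auto simp: strict_mono_def intro!: diff_less_mono)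
    note reindex = sums_mono_reindex[OF this, where f = "\<lambda>n. taylor_coeff (deriv f) n * z ^ n"]
    have tc: "taylor_coeff (deriv f) n = of_nat (Suc n) * of_real (gap_coeff (\<lambda>k. 2 ^ k) a (Suc n))" for n
      by (simp only: taylor_coeff_deriv) (simp only: f_def taylor_coeff_gap_series[OF strict_mono_power2 a'])
    have "taylor_coeff (deriv f) n = 0" if "n \<notin> range ?N" for n
    proof -
      have "Suc n \<notin> range (\<lambda>k. 2 ^ k)" proof
        assume "Suc n \<in> range (\<lambda>k. 2 ^ k)"
        then obtain k where "Suc n = 2 ^ k" by blast
        then have "n = ?N k" by simp
        then show False using that by blast
      qed
      then show ?thesis by (simp add: tc gap_coeff_def)
    qed
    moreover have "taylor_coeff (deriv f) (?N k) = of_real (a k) * 2 ^ k" for k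
    proof -
      have "Suc (?N k) = 2 ^ k" by simp
      then show ?thesis unfolding tc by (simp only: gap_coeff_at[OF strict_mono_power2]) simp
    qed
    ultimately show ?thesis using taylor_sums[OF f' z] reindex by (simp add: mult.assoc)
  qed
  have x0: "0 \<le> x r k" if "0 \<le> r" for r k using that by (simp add: x_def)
  have y_sum: "summable (\<lambda>k. a k powr p * x r k)" if r: "0 \<le> r" "r < 1" for r
  proof -
    have sx: "summable (x r)"
    proof (rule bounded_imp_summable)
      show "0 \<le> x r k" for k using x0 r by simp
      show "(\<Sum>k\<le>K. x r k) \<le> 2 / (1 - r)" for K
        using dyadic_sum_le[OF r, of "Suc K"] by (simp only: x_def lessThan_Suc_atMost)
    qed
    show ?thesis
    proof (rule summable_comparison_test'[OF sx])
      fix k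
      have "a k powr p \<le> 1" using a[of k] p by (intro powr_le1) auto
      then show "norm (a k powr p * x r k) \<le> x r k" using x0[of r k] r by (simp add: mult_left_le_one_le)
    qed
  qed
  define C where "C = 4 powr (p - 1)"
  let ?u = "\<lambda>z. norm (deriv f z) powr p * (1 - (norm z)\<^sup>2) powr (p - 1)"
  have pointwise: "?u z \<le> C * (\<Sum>k. a k powr p * x (norm z) k)" if z: "z \<in> unit_disc" for z
  proof -
    let ?r = "norm z"
    have r: "0 \<le> ?r" "?r < 1" using z by auto
    define T where "T K = (\<Sum>k<K. of_real (a k) * (2 ^ k * z ^ (2 ^ k - 1)))" for K
    have "T \<longlonglongrightarrow> deriv f z" unfolding T_def[abs_def] using deriv_sums[OF z] by (simp only: sums_def)
    then have "(\<lambda>K. norm (T K) powr p * (1 - ?r\<^sup>2) powr (p - 1)) \<longlonglongrightarrow> ?u z"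
      using p by (intro tendsto_intros tendsto_powr') auto
    moreover have "norm (T K) powr p * (1 - ?r\<^sup>2) powr (p - 1) \<le> C * (\<Sum>k. a k powr p * x ?r k)" if K: "K \<ge> 1" for K
    proof -
      let ?X = "\<Sum>k<K. x ?r k"
      \<comment> \<open>Jensen divides by the sum of the weights, hence \<open>K \<ge> 1\<close>: the first term alone is one, even at \<open>r = 0\<close>.\<close>
      have "1 = x ?r 0" by (simp add: x_def)
      also have "\<dots> \<le> ?X" using K x0 r by (intro member_le_sum) auto
      finally have X: "0 < ?X" by simp
      have X2: "?X \<le> 2 / (1 - ?r)" unfolding x_def by (rule dyadic_sum_le[OF r])
      have "norm (T K) \<le> (\<Sum>k<K. a k * x ?r k)"
        unfolding T_def by (rule order_trans[OF norm_sum]) (use a in \<open>auto simp: norm_mult norm_power x_def less_imp_le\<close>)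
      then have "norm (T K) powr p \<le> (\<Sum>k<K. a k * x ?r k) powr p" using p by (intro powr_mono2) auto
      also have "\<dots> \<le> ?X powr (p - 1) * (\<Sum>k<K. a k powr p * x ?r k)"
        using p a x0 r X by (intro power_mean_weighted) auto
      also have "\<dots> \<le> (2 / (1 - ?r)) powr (p - 1) * (\<Sum>k. a k powr p * x ?r k)"
        using p X X2 x0 r y_sum by (intro mult_mono powr_mono2 sum_le_suminf sum_nonneg) auto
      finally have "norm (T K) powr p * (1 - ?r\<^sup>2) powr (p - 1) \<le>
          ((2 / (1 - ?r)) powr (p - 1) * (\<Sum>k. a k powr p * x ?r k)) * (2 * (1 - ?r)) powr (p - 1)"
      proof (rule mult_mono)
        have "1 - ?r\<^sup>2 = (1 + ?r) * (1 - ?r)" by (simp add: power2_eq_square algebra_simps)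
        also have "\<dots> \<le> 2 * (1 - ?r)" using r by (intro mult_right_mono) auto
        finally show "(1 - ?r\<^sup>2) powr (p - 1) \<le> (2 * (1 - ?r)) powr (p - 1)"
          using r p by (intro powr_mono2) (auto simp: power_le_one)
        show "0 \<le> (2 / (1 - ?r)) powr (p - 1) * (\<Sum>k. a k powr p * x ?r k)"
          using y_sum r x0 by (intro mult_nonneg_nonneg suminf_nonneg) auto
      qed auto
      also have "\<dots> = (2 / (1 - ?r) * (2 * (1 - ?r))) powr (p - 1) * (\<Sum>k. a k powr p * x ?r k)"
        unfolding powr_mult by (simp only: mult_ac)
      also have "2 / (1 - ?r) * (2 * (1 - ?r)) = 4" using r by (simp add: field_simps)
      finally show ?thesis by (simp add: C_def)
    qed
    ultimately show ?thesis by (intro LIMSEQ_le_const2) auto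
  qed
  have C: "0 \<le> C" by (simp add: C_def)
  have cu: "continuous_on unit_disc ?u"
    by (intro continuous_on_mult continuous_on_powr' continuous_intros holomorphic_on_imp_continuous_on f')
       (use p in \<open>auto simp: power_le_one\<close>)
  let ?w = "\<lambda>k r. 2 * C * (a k powr p * x r k)"
  have w: "(\<lambda>k. ?w k r) sums (2 * (C * (\<Sum>k. a k powr p * x r k)))" if "0 \<le> r" "r < 1" for r
    using sums_mult[OF summable_sums[OF y_sum[OF that]], of "2 * C"] by (simp add: mult.assoc)
  have "(\<integral>\<^sup>+z\<in>unit_disc. ennreal (?u z) \<partial>disc_area) \<le> (\<integral>\<^sup>+r\<in>{0<..<1}. ennreal (2 * (C * (\<Sum>k. a k powr p * x r k))) \<partial>lborel)"
  proof (rule nn_integral_disc_le_radial[OF cu])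
    fix r :: real assume r: "0 < r" "r < 1"
    have "circle_mean ?u r \<le> circle_mean (\<lambda>z. C * (\<Sum>k. a k powr p * x r k)) r"
      using r pointwise by (intro circle_mean_mono cu continuous_intros) auto
    then show "circle_mean ?u r \<le> C * (\<Sum>k. a k powr p * x r k)" by (simp add: circle_mean_def)
  qed simp
  also have "\<dots> = (\<integral>\<^sup>+r. (\<Sum>k. ennreal (?w k r) * indicator {0<..<1} r) \<partial>lborel)"
  proof (intro nn_integral_cong)
    fix r :: real
    show "ennreal (2 * (C * (\<Sum>k. a k powr p * x r k))) * indicator {0<..<1} r = (\<Sum>k. ennreal (?w k r) * indicator {0<..<1} r)"
    proof (cases "r \<in> {0<..<1}")
      case True
      then have "(\<Sum>k. ennreal (?w k r)) = ennreal (\<Sum>k. ?w k r)"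
        using w[of r] x0[of r] C by (intro suminf_ennreal2) (auto simp: sums_iff)
      then show ?thesis using True w[of r] by (simp add: sums_iff)
    qed simp
  qed
  also have "\<dots> = (\<Sum>k. \<integral>\<^sup>+r\<in>{0<..<1}. ennreal (?w k r) \<partial>lborel)"
    unfolding x_def by (rule nn_integral_suminf) measurable
  also have "\<dots> \<le> (\<Sum>k. ennreal (2 * C * a k powr p))"
  proof (intro suminf_le summableI)
    fix k
    let ?F = "\<lambda>r. 2 * C * (a k powr p * r ^ (2 ^ k))"
    have "(\<integral>\<^sup>+r\<in>{0<..<1}. ennreal (?w k r) \<partial>lborel) \<le> ennreal (?F 1 - ?F 0)"
    proof (rule nn_integral_unit_interval_FTC)
      fix r :: real assume r: "0 \<le> r" "r \<le> 1"
      have "((\<lambda>r. r ^ (2 ^ k)) has_real_derivative x r k) (at r)"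
        using DERIV_pow[of "2 ^ k" r] by (simp add: x_def)
      then show "(?F has_real_derivative ?w k r) (at r)" by (intro DERIV_cmult)
      show "0 \<le> ?w k r" using x0 r C by simp
    qed (unfold x_def, measurable)
    also have "?F 1 - ?F 0 = 2 * C * a k powr p" by simp
    finally show "(\<integral>\<^sup>+r\<in>{0<..<1}. ennreal (?w k r) \<partial>lborel) \<le> ennreal (2 * C * a k powr p)" .
  qed
  also have "\<dots> = ennreal (\<Sum>k. 2 * C * a k powr p)"
    using C s by (intro suminf_ennreal2 summable_mult) auto
  also have "\<dots> < \<infinity>" by simp
  finally have "dirichlet_energy p f < \<infinity>" by (simp add: dirichlet_energy_def)
  then show ?thesis using f by (simp add: dirichlet_space_def f_def)
qed

section \<open>A symbol in the disc algebra with an unbounded operator\<close>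

text \<open>
  The coefficient of order \<open>j + m\<close> of \<open>T_op g f\<close> is a convolution of non-negative numbers divided by \<open>j + m\<close>. Nothing can cancel, so
  the single contribution \<open>m b(m) c(j) / (j + m)\<close> is a lower bound.
\<close>

lemma T_op_coeff_lower_bound:
  assumes f: "f holomorphic_on unit_disc" and g: "g holomorphic_on unit_disc"
    and cf: "\<And>n. taylor_coeff f n = of_real (c n)" "\<And>n. 0 \<le> c n"
    and cg: "\<And>n. taylor_coeff g n = of_real (b n)" "\<And>n. 0 \<le> b n"
    and j: "j \<le> m" "1 \<le> m"
  shows "b m * c j / 2 \<le> norm (taylor_coeff (T_op g f) (j + m))"
proof -
  let ?F = "T_op g f"
  define n where "n = j + m - 1"
  have n: "Suc n = j + m" "n - j = m - 1" "Suc (m - 1) = m" "j \<le> n" using j by (auto simp: n_def)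
  have F: "?F holomorphic_on unit_disc" by (rule T_op_holomorphic[OF f g])
  have g': "deriv g holomorphic_on unit_disc" by (intro holomorphic_deriv g) auto
  let ?t = "\<lambda>i. c i * (real (Suc (n - i)) * b (Suc (n - i)))"
  have "taylor_coeff (deriv ?F) n = taylor_coeff (\<lambda>z. f z * deriv g z) n"
    by (rule taylor_coeff_cong)
       (auto intro!: holomorphic_intros f g' holomorphic_deriv F DERIV_imp_deriv T_op_has_derivative g)
  also have "\<dots> = of_real (\<Sum>i\<le>n. ?t i)"
    unfolding taylor_coeff_mult[OF f g'] taylor_coeff_deriv cf cg by simp
  finally have "of_nat (j + m) * taylor_coeff ?F (j + m) = of_real (\<Sum>i\<le>n. ?t i)"
    by (simp only: taylor_coeff_deriv n)
  then have "norm (of_nat (j + m) * taylor_coeff ?F (j + m)) = \<bar>\<Sum>i\<le>n. ?t i\<bar>" by (simp only: norm_of_real)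
  also have "\<dots> = (\<Sum>i\<le>n. ?t i)" using cf(2) cg(2) by (intro abs_of_nonneg sum_nonneg mult_nonneg_nonneg) auto
  finally have e: "real (j + m) * norm (taylor_coeff ?F (j + m)) = (\<Sum>i\<le>n. ?t i)"
    by (simp only: norm_mult norm_of_nat)
  have "c j * (real m * b m) = ?t j" by (simp only: n)
  also have "\<dots> \<le> (\<Sum>i\<le>n. ?t i)" using n cf(2) cg(2) by (intro member_le_sum) auto
  also have "\<dots> = real (j + m) * norm (taylor_coeff ?F (j + m))" using e ..
  also have "\<dots> \<le> (2 * real m) * norm (taylor_coeff ?F (j + m))" using j by (intro mult_right_mono) auto
  finally have "real m * (b m * c j) \<le> real m * (2 * norm (taylor_coeff ?F (j + m)))" by (simp add: mult_ac)
  then show ?thesis using j by simp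
qed

text \<open>
  For the monomial \<open>g = z^m\<close> the coefficients of \<open>T_op g f\<close> are at least half of the first \<open>m\<close> coefficients of \<open>f\<close>, so its square norm
  grows with \<open>m\<close> although the supremum norm of \<open>z^m\<close> is one. Superposing such monomials with weights \<open>2^(-k)\<close> along
  sufficiently rapidly growing exponents yields one \<open>g\<close>; positivity of all coefficients prevents cancellation.
\<close>

lemma exists_disc_algebra_symbol:
  assumes p: "2 < p" and f: "f holomorphic_on unit_disc"
    and cf: "\<And>n. taylor_coeff f n = of_real (c n)" "\<And>n. 0 \<le> c n"
    and div: "\<not> summable (\<lambda>n. (c n)\<^sup>2)"
  shows "\<exists>g\<in>disc_algebra. T_op g f \<notin> hardy_space p"
proof -
  let ?S = "\<lambda>m. \<Sum>j\<le>m. (c j)\<^sup>2"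
  have unb: "\<exists>m>n. B \<le> ?S m" for B n
  proof -
    obtain m where m: "B < ?S m"
      using bounded_imp_summable[of "\<lambda>n. (c n)\<^sup>2" B] div by (meson not_le zero_le_power2)
    have "?S m \<le> ?S (max m (Suc n))" by (intro sum_mono2) auto
    then show ?thesis using m by (intro exI[of _ "max m (Suc n)"]) auto
  qed
  \<comment> \<open>The weight \<open>2^(-k)\<close> enters squared; against \<open>4^k * k\<close> a contribution of order \<open>k\<close> is left.\<close>
  have "\<exists>N. \<forall>k. (0 < N k \<and> 4 ^ k * real k \<le> ?S (N k)) \<and> N k < N (Suc k)"
  proof (rule dependent_nat_choice)
    show "\<exists>m. 0 < m \<and> 4 ^ 0 * real 0 \<le> ?S m" using unb[of 0 0] by auto
    show "\<exists>m'. (0 < m' \<and> 4 ^ Suc k * real (Suc k) \<le> ?S m') \<and> m < m'" for m k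
      using unb[of m "4 ^ Suc k * real (Suc k)"] by (metis gr_zeroI not_less_zero)
  qed
  then obtain N where N: "\<And>k. 0 < N k" "\<And>k. 4 ^ k * real k \<le> ?S (N k)" "\<And>k. N k < N (Suc k)"
    by blast
  have sN: "strict_mono N" using N(3) by (simp add: strict_mono_Suc_iff)
  let ?a = "\<lambda>k. (1 / 2) ^ k :: real"
  have a: "\<bar>?a k\<bar> \<le> 1" for k by (simp add: power_le_one)
  define g where "g = gap_series N ?a"
  define b where "b = gap_coeff N ?a"
  have g: "g \<in> disc_algebra" unfolding g_def
    by (rule gap_series_disc_algebra[OF sN a]) (simp add: summable_geometric)
  have gh: "g holomorphic_on unit_disc" unfolding g_def by (rule gap_series_holomorphic[OF sN a])
  have cg: "taylor_coeff g n = of_real (b n)" "0 \<le> b n" for n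
    unfolding g_def b_def by (rule taylor_coeff_gap_series[OF sN a], rule gap_coeff_nonneg, simp)
  have "T_op g f \<notin> hardy_space p"
  proof
    assume F: "T_op g f \<in> hardy_space p"
    define K where "K = hardy_norm p (T_op g f) powr p + 1"
    have "real k / 4 \<le> K" for k
    proof -
      let ?m = "N k"
      have "(?a k)\<^sup>2 * 4 ^ k = ((1 / 2)\<^sup>2 * 4) ^ k"
        by (simp only: power_mult_distrib power_mult[symmetric] mult.commute)
      then have "(?a k)\<^sup>2 * 4 ^ k = 1" by (simp add: power2_eq_square)
      then have "real k / 4 = (?a k)\<^sup>2 / 4 * (4 ^ k * real k)" by (simp add: mult.assoc[symmetric] del: power_divide)
      also have "\<dots> \<le> (?a k)\<^sup>2 / 4 * ?S ?m" by (intro mult_left_mono N) auto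
      also have "\<dots> = (\<Sum>j\<le>?m. (b ?m * c j / 2)\<^sup>2)"
        by (simp add: b_def gap_coeff_at[OF sN] sum_distrib_left power_mult_distrib power_divide)
      also have "\<dots> \<le> (\<Sum>j\<le>?m. (norm (taylor_coeff (T_op g f) (j + ?m)))\<^sup>2)"
        using N(1)[of k] cf(2) cg(2)
        by (intro sum_mono power_mono T_op_coeff_lower_bound[OF f gh cf cg]) auto
      also have "\<dots> = (\<Sum>n\<in>(\<lambda>j. j + ?m) ` {..?m}. (norm (taylor_coeff (T_op g f) n))\<^sup>2)"
        by (subst sum.reindex) auto
      also have "\<dots> \<le> (\<Sum>n<2 * ?m + 1. (norm (taylor_coeff (T_op g f) n))\<^sup>2)"
        by (intro sum_mono2) auto
      also have "\<dots> \<le> K" unfolding K_def by (rule hardy_imp_square_summable[OF F p])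
      finally show ?thesis .
    qed
    note le = this
    obtain k :: nat where "4 * K < real k" using reals_Archimedean2 by blast
    then show False using le[of k] by simp
  qed
  then show ?thesis using g by blast
qed

text \<open>
  The coefficients \<open>(k + 1)^(- 1/2)\<close> have divergent squares but summable \<open>p\<close>-th powers, which separates the Dirichlet-type
  space from the square-summable series for every \<open>p > 2\<close>.
\<close>

lemma exists_unbounded_disc_algebra_symbol:
  assumes p: "2 < p"
  shows "\<exists>g\<in>disc_algebra. \<exists>f\<in>dirichlet_space p. T_op g f \<notin> hardy_space p"
proof -
  let ?a = "\<lambda>k. real (Suc k) powr (- 1 / 2)"
  let ?N = "\<lambda>k. 2 ^ k :: nat"
  have a: "0 < ?a k" "?a k \<le> 1" for k
    by (auto simp: powr_minus_divide divide_le_eq_1 intro!: ge_one_powr_ge_zero)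
  then have a': "\<bar>?a k\<bar> \<le> 1" for k by (simp add: abs_of_pos)
  let ?f = "gap_series ?N ?a"
  have "summable (\<lambda>n. real n powr (- p / 2))" using p by (subst summable_real_powr_iff) simp
  then have "summable (\<lambda>k. real (Suc k) powr (- p / 2))" by (subst summable_Suc_iff)
  then have "summable (\<lambda>k. ?a k powr p)" by (simp add: powr_powr)
  then have f: "?f \<in> dirichlet_space p" using p a by (intro lacunary_in_dirichlet_space) auto
  have fh: "?f holomorphic_on unit_disc" by (rule gap_series_holomorphic[OF strict_mono_power2 a'])
  have "\<not> summable (\<lambda>n. (gap_coeff ?N ?a n)\<^sup>2)"
  proof
    assume "summable (\<lambda>n. (gap_coeff ?N ?a n)\<^sup>2)"
    then have "summable (\<lambda>k. (gap_coeff ?N ?a (?N k))\<^sup>2)"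
      by (rule summable_mono_reindex[OF strict_mono_power2, THEN iffD2, rotated]) (simp add: gap_coeff_def)
    then have "summable (\<lambda>k. (?a k)\<^sup>2)" by (simp only: gap_coeff_at[OF strict_mono_power2])
    moreover have "(?a k)\<^sup>2 = inverse (real (Suc k))" for k
    proof -
      have "(?a k)\<^sup>2 = real (Suc k) powr (- 1 / 2 + - 1 / 2)" by (simp only: power2_eq_square powr_add)
      also have "- 1 / 2 + - 1 / 2 = (- 1 :: real)" by simp
      finally show ?thesis by (simp add: powr_minus)
    qed
    ultimately have "summable (\<lambda>k. inverse (real (Suc k)))" by (simp only:)
    then have "summable (\<lambda>k. inverse (real k))" by (subst (asm) summable_Suc_iff)
    then show False using not_summable_harmonic[where 'a = real] by simp
  qed
  then show ?thesis
  proof -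
    have "\<exists>g\<in>disc_algebra. T_op g ?f \<notin> hardy_space p"
    proof (rule exists_disc_algebra_symbol[OF p fh])
      show "taylor_coeff ?f n = of_real (gap_coeff ?N ?a n)" for n
        by (rule taylor_coeff_gap_series[OF strict_mono_power2 a'])
      show "0 \<le> gap_coeff ?N ?a n" for n by (rule gap_coeff_nonneg) simp
    qed fact
    then show ?thesis using f by blast
  qed
qed

theorem theorem2:
  fixes p :: real
  assumes "2 < p"
  shows "(\<forall>g. g holomorphic_on unit_disc \<longrightarrow>
            bounded_operator (dirichlet_space p) (dirichlet_norm p)
              (hardy_space p) (hardy_norm p) (T_op g) \<longrightarrow>
            g \<in> BMOA)
       \<and> (\<exists>g\<in>disc_algebra. \<exists>f\<in>dirichlet_space p. T_op g f \<notin> hardy_space p)"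
  using T_op_bounded_imp_BMOA[OF assms] exists_unbounded_disc_algebra_symbol[OF assms] by blast

end
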